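(* Let $\Delta>0$, and let $\{X_n\}_{n\ge0}$ be the linearly edge-reinforced random walk on $\mathbb{Z}_+$ started at $0$ with initial weights $f(0,0)=1$, $f(0,x)=x$ for $x\in\{1,2,\dots\}$, and reinforcement parameter $\Delta$. (i) If $\Delta>2$, then for any $\varepsilon>0$, $$\limsup_{n\to\infty}\frac{X_n}{n^{(1-\varepsilon)/\Delta}}=+\infty\quad\text{and}\quad\lim_{n\to\infty}\frac{X_n}{n^{(1+\varepsilon)/\Delta}}=0\quad\text{almost surely.}$$ (ii) If $0<\Delta\le 2$, then for any $\varepsilon>0$, $$\limsup_{n\to\infty}\frac{X_n}{n^{(1-\varepsilon)/2}}=+\infty\quad\text{and}\quad\lim_{n\to\infty}\frac{X_n}{n^{(1+\varepsilon)/2}}=0\quad\text{almost surely.}$$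
   Context: $\mathbb{Z}_+=\{0,1,2,\dots\}$. The linearly edge-reinforced random walk (LERRW) on $\mathbb{Z}_+$ with initial weights $f(0,x)>0$ ($x\in\mathbb{Z}_+$) and reinforcement parameter $\Delta\ge 0$ is the nearest-neighbour process $\{X_n\}_{n\ge0}$ on $\mathbb{Z}_+$ with $P(X_0=0)=1$ defined as follows. For $x\in\mathbb{Z}_+$ let $\phi_n(x)=\sum_{i=1}^n 1_{\{\{X_{i-1},X_i\}=\{x,x+1\}\}}$ be the number of traversals of the edge $\{x,x+1\}$ by time $n$, and let the weight of the edge $\{x,x+1\}$ at time $n$ be $w_n(x)=f(0,x)+\Delta\,\phi_n(x)$; set $w_n(-1)=0$ for all $n$. The transition probabilities are $$P(X_{n+1}=X_n+1\mid X_0,\dots,X_n)=1-P(X_{n+1}=X_n-1\mid X_0,\dots,X_n)=\frac{w_n(X_n)}{w_n(X_n-1)+w_n(X_n)}.$$ *)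

theory Defs
  imports "HOL-Probability.Probability"
begin

definition edge_traversals :: "(nat \<Rightarrow> nat) \<Rightarrow> nat \<Rightarrow> nat \<Rightarrow> nat" where
  "edge_traversals p n x = card {i \<in> {1..n}. {p (i - 1), p i} = {x, x + 1}}"

text \<open>Edges are indexed by integers, \<open>x\<close> standing for the edge between \<open>x\<close> and \<open>x + 1\<close>,
  so that the index \<open>-1\<close>, which carries weight zero, is available at the left end point.\<close>

definition edge_weight :: "(nat \<Rightarrow> real) \<Rightarrow> real \<Rightarrow> (nat \<Rightarrow> nat) \<Rightarrow> nat \<Rightarrow> int \<Rightarrow> real" where
  "edge_weight f \<Delta> p n x =
     (if x < 0 then 0 else f (nat x) + \<Delta> * real (edge_traversals p n (nat x)))"

definition step_right_prob :: "(nat \<Rightarrow> real) \<Rightarrow> real \<Rightarrow> (nat \<Rightarrow> nat) \<Rightarrow> nat \<Rightarrow> real" where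
  "step_right_prob f \<Delta> p n =
     edge_weight f \<Delta> p n (int (p n)) /
       (edge_weight f \<Delta> p n (int (p n) - 1) + edge_weight f \<Delta> p n (int (p n)))"

definition past :: "'a measure \<Rightarrow> (nat \<Rightarrow> 'a \<Rightarrow> nat) \<Rightarrow> nat \<Rightarrow> 'a measure" where
  "past M X n = sigma (space M) {X i -` A \<inter> space M | i A. i \<le> n}"

text \<open>Conditional probabilities given \<open>X 0, \<dots>, X n\<close> are conditional expectations of
  indicators. A step to the left is written \<open>X (Suc n) \<omega> + 1 = X n \<omega>\<close> because subtraction
  on the natural numbers truncates at zero.\<close>

locale lerrw = prob_space M
  for M :: "'a measure" +
  fixes X :: "nat \<Rightarrow> 'a \<Rightarrow> nat" and f :: "nat \<Rightarrow> real" and \<Delta> :: real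
  assumes initial_weight_pos: "\<And>x. f x > 0"
    and reinforcement_nonneg: "\<Delta> \<ge> 0"
    and measurable_X: "\<And>n. random_variable (count_space UNIV) (X n)"
    and start: "prob {\<omega> \<in> space M. X 0 \<omega> = 0} = 1"
    and step_right: "\<And>n. AE \<omega> in M.
      real_cond_exp M (past M X n) (indicator {\<omega> \<in> space M. X (Suc n) \<omega> = X n \<omega> + 1}) \<omega>
        = step_right_prob f \<Delta> (\<lambda>i. X i \<omega>) n"
    and step_left: "\<And>n. AE \<omega> in M.
      real_cond_exp M (past M X n) (indicator {\<omega> \<in> space M. X (Suc n) \<omega> + 1 = X n \<omega>}) \<omega>
        = 1 - step_right_prob f \<Delta> (\<lambda>i. X i \<omega>) n"

end

theory Submission
  imports Defs "HOL-Real_Asymp.Real_Asymp"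
begin

text \<open>
  Whenever the walk stands at \<open>x\<close>, the edge to its right has been crossed an even number of times
  and, if \<open>x > 0\<close>, the edge to its left an odd number of times. Between two visits to \<open>x\<close> exactly
  one of the two edges gains \<open>2\<Delta>\<close>. The decisions taken at \<open>x\<close> are therefore draws from a Polya urn,
  the urns of different vertices do not interact, and a Polya urn is a mixture of coin tossings with
  a Beta distributed bias. Hence the reinforced walk is a mixture of ordinary random walks in
  an environment of independent biases \<open>u x\<close>, Beta distributed with parameters \<open>f x / 2\<Delta>\<close> and
  \<open>(f (x - 1) + \<Delta>) / 2\<Delta>\<close> (lemma \<open>emeasure_reach_eq\<close>).

  For a fixed environment the expected time \<open>h(x)\<close> to reach \<open>x\<close> from the origin makes
  \<open>h(X_n) - n\<close> a martingale. This one martingale controls both tails of the time \<open>T_N\<close> at which the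
  level \<open>N\<close> is reached: \<open>P(T_N \<le> n) \<le> n / h(N)\<close> and \<open>P(T_N > n) \<le> h(N) / n\<close>. So \<open>T_N\<close> has the order
  of magnitude of \<open>h(N)\<close>, which is an explicit sum of ratios \<open>W(x) / W(y)\<close>, \<open>y \<le> x < N\<close>, where
  \<open>W(x)\<close> is the product of the odds \<open>(1 - u j) / u j\<close>, \<open>1 \<le> j \<le> x\<close>.

  For the weights \<open>f x = x\<close> the logarithm of the odds at \<open>j\<close> has mean about \<open>(\<Delta> - 1) / j\<close> and variance
  of order \<open>1 / j\<close>. So \<open>log W(x)\<close> is \<open>(\<Delta> - 1) log x\<close> with fluctuations of order
  \<open>sqrt (log x)\<close>, and \<open>W(x)\<close> is \<open>x powr (\<Delta> - 1)\<close> up to factors \<open>N powr \<eta>\<close>,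
  simultaneously for all \<open>x < N\<close>, outside an event of probability polynomially small in \<open>N\<close>. This follows from
  the moments of small order \<open>s\<close>, of either sign, of the odds and a maximal inequality
  (lemma \<open>irregular_env_prob\<close>). Consequently \<open>h(N)\<close> is about \<open>N powr \<gamma>\<close> with \<open>\<gamma> = max 2 \<Delta>\<close>: for \<open>\<Delta> > 2\<close>
  the small values of \<open>y\<close> dominate the sum and give \<open>N powr \<Delta>\<close>, while for \<open>\<Delta> < 2\<close> the pairs
  with \<open>x\<close> and \<open>y\<close> of order \<open>N\<close> dominate and give \<open>N^2\<close>.

  Integrating the two tail bounds over the environment and applying the Borel-Cantelli lemma at the
  times \<open>2 ^ k\<close> shows that the maximum of the walk up to time \<open>n\<close> is \<open>n powr (1 / \<gamma> + o(1))\<close> almost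
  surely, and both claims follow.
\<close>

section \<open>Beta laws and the digamma function\<close>

definition beta_law :: "real \<Rightarrow> real \<Rightarrow> real measure" where
  "beta_law a b = density lborel
     (\<lambda>t. ennreal (indicator {0<..<1} t * (t powr (a - 1) * (1 - t) powr (b - 1)) / Beta a b))"

lemma sets_beta_law [simp, measurable_cong]: "sets (beta_law a b) = sets borel"
  by (simp add: beta_law_def)

lemma space_beta_law [simp]: "space (beta_law a b) = UNIV"
  by (simp add: beta_law_def)

lemma Beta_real_pos: "a > 0 \<Longrightarrow> b > 0 \<Longrightarrow> Beta a b > (0::real)"
  by (simp add: Beta_def Gamma_real_pos)

text \<open>
  One integral serves two purposes: natural exponents \<open>c\<close> and \<open>d\<close> give the probabilities of the
  Polya urn, and \<open>c = - d\<close> gives the moments of the odds.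
\<close>

lemma nn_integral_beta_law:
  assumes "a > 0" "b > 0" "a + c > 0" "b + d > 0"
  shows "(\<integral>\<^sup>+t. ennreal (t powr c * (1 - t) powr d) \<partial>beta_law a b)
    = ennreal (Beta (a + c) (b + d) / Beta a b)"
proof -
  let ?h = "\<lambda>t::real. t powr (a + c - 1) * (1 - t) powr (b + d - 1)"
  have B: "Beta a b > 0" using assms by (simp add: Beta_real_pos)
  have "(?h has_integral Beta (a + c) (b + d)) {0<..<1}"
    using has_integral_Beta_real[of "a + c" "b + d"] assms by (simp add: has_integral_Icc_iff_Ioo)
  then have I: "((\<lambda>t. ?h t / Beta a b) has_integral (Beta (a + c) (b + d) / Beta a b)) {0<..<1}"
    by (rule has_integral_divide)
  have "(\<integral>\<^sup>+t. ennreal (t powr c * (1 - t) powr d) \<partial>beta_law a b)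
    = (\<integral>\<^sup>+t. ennreal (?h t / Beta a b) * indicator {0<..<1} t \<partial>lborel)"
    unfolding beta_law_def
    apply (subst nn_integral_density)
      apply (simp_all)
    apply (intro nn_integral_cong)
    using B apply (auto simp: indicator_def ennreal_mult'[symmetric] powr_add powr_diff field_simps)
    done
  also have "\<dots> = ennreal (Beta (a + c) (b + d) / Beta a b)"
    by (rule nn_integral_has_integral_lebesgue'[OF _ I]) (use B in auto)
  finally show ?thesis .
qed

lemma AE_beta_law: "AE t in beta_law a b. 0 < t \<and> t < 1"
  unfolding beta_law_def by (subst AE_density) (auto simp: indicator_def)

lemma prob_space_beta_law:
  assumes "a > 0" "b > 0"
  shows "prob_space (beta_law a b)"
proof
  have "emeasure (beta_law a b) (space (beta_law a b)) = (\<integral>\<^sup>+t. 1 \<partial>beta_law a b)"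
    by simp
  also have "\<dots> = (\<integral>\<^sup>+t. ennreal (t powr 0 * (1 - t) powr 0) \<partial>beta_law a b)"
    by (rule nn_integral_cong_AE) (use AE_beta_law[of a b] in \<open>eventually_elim, simp\<close>)
  also have "\<dots> = 1"
    using nn_integral_beta_law[OF assms, of 0 0] assms Beta_real_pos[OF assms] by simp
  finally show "emeasure (beta_law a b) (space (beta_law a b)) = 1" .
qed

text \<open>
  By log-convexity of the Gamma function, its logarithm lies above its tangent at \<open>x\<close>.
\<close>

lemma ln_Gamma_tangent:
  assumes "x > 0" "y > (0::real)"
  shows "ln_Gamma x - ln_Gamma y \<le> (x - y) * Digamma x"
proof -
  have "\<exists>z. min x y \<le> z \<and> z \<le> max x y \<and> ln_Gamma x - ln_Gamma y = (x - y) * Digamma z"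
  proof (cases x y rule: linorder_cases)
    case less
    then obtain z where "x < z" "z < y" "ln_Gamma y - ln_Gamma x = (y - x) * Digamma z"
      using MVT2[of x y ln_Gamma Digamma] assms by (force intro!: derivative_eq_intros)
    then show ?thesis by (intro exI[of _ z]) (auto simp: algebra_simps)
  next
    case greater
    then obtain z where "y < z" "z < x" "ln_Gamma x - ln_Gamma y = (x - y) * Digamma z"
      using MVT2[of y x ln_Gamma Digamma] assms by (force intro!: derivative_eq_intros)
    then show ?thesis by (intro exI[of _ z]) auto
  qed auto
  then obtain z where z: "min x y \<le> z" "z \<le> max x y" "ln_Gamma x - ln_Gamma y = (x - y) * Digamma z"
    by blast
  have "(x - y) * Digamma z \<le> (x - y) * Digamma x"
  proof (cases "x \<le> y")
    case True
    then have "Digamma x \<le> Digamma z" using z assms by (intro Digamma_real_mono) auto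
    then show ?thesis using True by (simp add: mult_left_mono_neg)
  next
    case False
    then have "Digamma z \<le> Digamma x" using z assms by (intro Digamma_real_mono) auto
    then show ?thesis using False by (simp add: mult_left_mono)
  qed
  then show ?thesis using z by simp
qed

text \<open>
  The exponent \<open>- s\<close> of \<open>t\<close> and the exponent \<open>s\<close> of \<open>1 - t\<close> cancel in the sum of the two parameters,
  so the moment is \<open>\<Gamma>(a - s) / \<Gamma>(a)\<close> times \<open>\<Gamma>(b + s) / \<Gamma>(b)\<close>, and each quotient is bounded by the
  tangent inequality at its shifted argument. The tangent is taken there because the resulting error is
  quadratic in \<open>s\<close>: a bound that loses a term linear in \<open>s\<close> would change the growth
  exponent. No sign of \<open>s\<close> is assumed, so that upper and lower tails are treated at once.
\<close>

lemma nn_integral_odds_powr_beta_law_le: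
  assumes "a > 0" "b > 0" "a - s > 0" "b + s > 0"
  shows "(\<integral>\<^sup>+t. ennreal (((1 - t) / t) powr s) \<partial>beta_law a b)
    \<le> ennreal (exp (s * (Digamma (b + s) - Digamma (a - s))))"
proof -
  have "(\<integral>\<^sup>+t. ennreal (((1 - t) / t) powr s) \<partial>beta_law a b)
      = (\<integral>\<^sup>+t. ennreal (t powr (- s) * (1 - t) powr s) \<partial>beta_law a b)"
    by (rule nn_integral_cong_AE)
       (use AE_beta_law[of a b] in \<open>eventually_elim, auto simp: powr_divide powr_minus field_simps\<close>)
  also have "\<dots> = ennreal (Beta (a - s) (b + s) / Beta a b)"
    using nn_integral_beta_law[of a b "-s" s] assms by simp
  also have "Beta (a - s) (b + s) / Beta a b = Gamma (a - s) / Gamma a * (Gamma (b + s) / Gamma b)"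
    using assms Gamma_real_pos[of "a + b", THEN less_imp_neq] by (simp add: Beta_def field_simps)
  also have "\<dots> = exp ((ln_Gamma (a - s) - ln_Gamma a) + (ln_Gamma (b + s) - ln_Gamma b))"
    using assms by (simp add: exp_add exp_diff Gamma_real_pos_exp)
  also have "\<dots> \<le> exp (s * (Digamma (b + s) - Digamma (a - s)))"
    using ln_Gamma_tangent[of "a - s" a] ln_Gamma_tangent[of "b + s" b] assms
    by (simp add: algebra_simps)
  finally show ?thesis by (simp add: ennreal_leI)
qed

text \<open>
  The trigamma function is the sum of \<open>1 / (x + k)^2\<close>, which is compared with the telescoping
  series of \<open>1 / (x + k) - 1 / (x + k + 1)\<close>.
\<close>

lemma Trigamma_bounds:
  assumes "x > (0::real)"
  shows "1 / x \<le> Polygamma 1 x" and "Polygamma 1 x \<le> 1 / x + 1 / x\<^sup>2"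
proof -
  have S: "(\<lambda>k. inverse ((x + real k)\<^sup>2)) sums Polygamma 1 x"
    using Polygamma_LIMSEQ[of x 1] assms by (simp add: eval_nat_numeral)
  have T: "(\<lambda>k. 1 / (y + real k) - 1 / (y + real (Suc k))) sums (1 / y)" if "y > 0" for y :: real
  proof -
    have "(\<lambda>k. 1 / (y + real k)) \<longlonglongrightarrow> 0" by real_asymp
    from telescope_sums'[OF this] show ?thesis by simp
  qed
  have below: "1 / y - 1 / (y + 1) \<le> inverse (y\<^sup>2)"
    and above: "inverse ((y + 1)\<^sup>2) \<le> 1 / y - 1 / (y + 1)" if "y > 0" for y :: real
  proof -
    have "1 / y - 1 / (y + 1) = 1 / (y * (y + 1))" using that by (simp add: field_simps)
    moreover have "1 / (y * (y + 1)) \<le> 1 / (y * y)" "1 / ((y + 1) * (y + 1)) \<le> 1 / (y * (y + 1))"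
      using that by (auto intro!: divide_left_mono mult_left_mono mult_right_mono)
    ultimately show "1 / y - 1 / (y + 1) \<le> inverse (y\<^sup>2)"
      "inverse ((y + 1)\<^sup>2) \<le> 1 / y - 1 / (y + 1)"
      by (simp_all add: power2_eq_square inverse_eq_divide)
  qed
  have "1 / (x + real k) - 1 / (x + real (Suc k)) \<le> inverse ((x + real k)\<^sup>2)" for k
    using below[of "x + real k"] assms by (simp add: add_ac)
  from sums_le[OF this T[OF assms] S] show "1 / x \<le> Polygamma 1 x" .
  have S': "(\<lambda>k. inverse ((x + real (Suc k))\<^sup>2)) sums (Polygamma 1 x - 1 / x\<^sup>2)"
    using S by (subst sums_Suc_iff) (simp add: inverse_eq_divide)
  have "inverse ((x + real (Suc k))\<^sup>2) \<le> 1 / (x + real k) - 1 / (x + real (Suc k))" for k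
    using above[of "x + real k"] assms by (simp add: add_ac)
  from sums_le[OF this S' T[OF assms]] show "Polygamma 1 x \<le> 1 / x + 1 / x\<^sup>2" by simp
qed

text \<open>
  The mean value theorem with the trigamma function as derivative, which is \<open>1 / z\<close> up to \<open>1 / z^2\<close>.
  For arguments that grow linearly in \<open>j\<close> at bounded distance from \<open>t\<close> the error is summable in \<open>j\<close>.
\<close>

lemma Digamma_diff_approx:
  fixes a b c t K :: real
  assumes "0 < c" "0 < j" "c * j \<le> a" "c * j \<le> b" "c * j \<le> t"
    and "\<bar>a - t\<bar> \<le> K" "\<bar>b - t\<bar> \<le> K" 
  shows "\<bar>Digamma b - Digamma a - (b - a) / t\<bar> \<le> 2 * K * (1 + K) / c\<^sup>2 / j\<^sup>2"
proof -
  have cj: "c * j > 0" using assms by simp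
  have K: "K \<ge> 0" using assms by linarith
  have D: "(Digamma has_real_derivative Polygamma 1 x) (at x)" if "x \<ge> c * j" for x
  proof -
    have "x \<notin> \<int>\<^sub>\<le>\<^sub>0" using that cj by (auto elim!: nonpos_Ints_cases)
    from has_field_derivative_Polygamma[OF this, of 0] show ?thesis by simp
  qed
  have "\<exists>z. min a b \<le> z \<and> z \<le> max a b \<and> Digamma b - Digamma a = (b - a) * Polygamma 1 z"
  proof (cases a b rule: linorder_cases)
    case less
    then obtain z where "a < z" "z < b" "Digamma b - Digamma a = (b - a) * Polygamma 1 z"
      using MVT2[of a b Digamma "Polygamma 1"] D assms(3) by (meson order.trans)
    then show ?thesis by (intro exI[of _ z]) auto
  next
    case greater
    then obtain z where "b < z" "z < a" "Digamma a - Digamma b = (a - b) * Polygamma 1 z"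
      using MVT2[of b a Digamma "Polygamma 1"] D assms(4) by (meson order.trans)
    then show ?thesis by (intro exI[of _ z]) (auto simp: algebra_simps)
  qed auto
  then obtain z where z: "min a b \<le> z" "z \<le> max a b"
    and eq: "Digamma b - Digamma a = (b - a) * Polygamma 1 z" by blast
  have zc: "c * j \<le> z" using z assms by linarith
  have zt: "\<bar>t - z\<bar> \<le> K" using z assms by linarith
  have z0: "z > 0" "t > 0" using zc cj assms by linarith+
  have "\<bar>Polygamma 1 z - 1 / t\<bar> \<le> \<bar>1 / z - 1 / t\<bar> + 1 / z\<^sup>2"
    using Trigamma_bounds[of z] z0 by (simp add: abs_le_iff abs_if)
  also have "\<bar>1 / z - 1 / t\<bar> = \<bar>t - z\<bar> / (z * t)" using z0 by (simp add: field_simps abs_if)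
  also have "\<dots> \<le> K / (c * j)\<^sup>2"
    unfolding power2_eq_square using zt zc assms cj K z0 by (intro frac_le mult_mono) auto
  also have "1 / z\<^sup>2 \<le> 1 / (c * j)\<^sup>2" using zc cj z0(1)
    by (intro divide_left_mono power_mono mult_pos_pos[of "z\<^sup>2"] zero_less_power) linarith+
  finally have P: "\<bar>Polygamma 1 z - 1 / t\<bar> \<le> (1 + K) / (c * j)\<^sup>2" by (simp add: add_divide_distrib)
  have "\<bar>Digamma b - Digamma a - (b - a) / t\<bar> = \<bar>b - a\<bar> * \<bar>Polygamma 1 z - 1 / t\<bar>"
    unfolding eq by (simp add: algebra_simps flip: abs_mult)
  also have "\<dots> \<le> (2 * K) * ((1 + K) / (c * j)\<^sup>2)"
    using P assms K by (intro mult_mono) auto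
  finally show ?thesis by (simp add: power_mult_distrib)
qed


section \<open>The walk in a fixed environment\<close>

definition right_prob :: "(nat \<Rightarrow> real) \<Rightarrow> nat \<Rightarrow> real" where
  "right_prob u x = (if x = 0 then 1 else u x)"

text \<open>
  The probability that the walk in the environment \<open>u\<close> started at \<open>x\<close> is at or above level \<open>N\<close> at
  some time up to \<open>n\<close>, computed by conditioning on the first step.
\<close>

fun hit_prob :: "(nat \<Rightarrow> real) \<Rightarrow> nat \<Rightarrow> nat \<Rightarrow> nat \<Rightarrow> real" where
  "hit_prob u N 0 x = of_bool (N \<le> x)"
| "hit_prob u N (Suc n) x = (if N \<le> x then 1 else
     right_prob u x * hit_prob u N n (x + 1) + (1 - right_prob u x) * hit_prob u N n (x - 1))"

definition odds :: "real \<Rightarrow> real" where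
  "odds t = (1 - t) / t"

definition odds_prod :: "(nat \<Rightarrow> real) \<Rightarrow> nat \<Rightarrow> real" where
  "odds_prod u x = (\<Prod>j\<in>{1..x}. odds (u j))"

text \<open>
  The expected time to step from \<open>x\<close> to \<open>x + 1\<close> for the first time. With \<open>r\<close> the odds at \<open>x + 1\<close>, the
  times \<open>c\<close> satisfy \<open>c(x + 1) + 1 = 2 + r (c(x) + 1)\<close>, and unrolling this recursion gives the sum.
\<close>

definition crossing_time :: "(nat \<Rightarrow> real) \<Rightarrow> nat \<Rightarrow> real" where
  "crossing_time u x = 2 * (\<Sum>y\<le>x. odds_prod u x / odds_prod u y) - 1"

definition hitting_time :: "(nat \<Rightarrow> real) \<Rightarrow> nat \<Rightarrow> real" where
  "hitting_time u x = (\<Sum>y<x. crossing_time u y)"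

lemma odds_prod_Suc: "odds_prod u (Suc x) = odds_prod u x * odds (u (Suc x))"
  by (simp add: odds_prod_def)

lemma odds_prod_pos:
  assumes "\<And>j. 1 \<le> j \<Longrightarrow> j \<le> x \<Longrightarrow> 0 < u j \<and> u j < 1"
  shows "odds_prod u x > 0"
  unfolding odds_prod_def using assms by (intro prod_pos) (auto simp: odds_def)

lemma crossing_time_Suc:
  assumes "\<And>j. 1 \<le> j \<Longrightarrow> j \<le> Suc x \<Longrightarrow> 0 < u j \<and> u j < 1"
  shows "u (Suc x) * crossing_time u (Suc x) = 1 + (1 - u (Suc x)) * crossing_time u x"
proof -
  have u: "0 < u (Suc x)" "u (Suc x) < 1" using assms[of "Suc x"] by auto
  have p: "odds_prod u (Suc x) > 0" using assms by (intro odds_prod_pos) auto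
  have "(\<Sum>y\<le>Suc x. odds_prod u (Suc x) / odds_prod u y)
      = 1 + odds (u (Suc x)) * (\<Sum>y\<le>x. odds_prod u x / odds_prod u y)"
    using p[THEN less_imp_neq] by (auto simp: odds_prod_Suc sum_distrib_left mult_ac)
  then show ?thesis using u unfolding crossing_time_def
    by (simp add: odds_def field_simps)
qed

lemma sum_odds_prod_ratio_ge_1:
  assumes "\<And>j. 1 \<le> j \<Longrightarrow> j \<le> x \<Longrightarrow> 0 < u j \<and> u j < 1"
  shows "1 \<le> (\<Sum>y\<le>x. odds_prod u x / odds_prod u y)"
proof -
  have pos: "odds_prod u y > 0" if "y \<le> x" for y
    using assms that by (intro odds_prod_pos) auto
  have "odds_prod u x / odds_prod u x \<le> (\<Sum>y\<le>x. odds_prod u x / odds_prod u y)"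
    by (intro member_le_sum) (use pos in \<open>auto intro: less_imp_le\<close>)
  with pos[of x] show ?thesis by simp
qed

text \<open>
  Stated without expectations: \<open>hitting_time u (X_n) - n\<close> is a martingale for the walk in the
  environment \<open>u\<close>.
\<close>

lemma hitting_time_generator:
  assumes "\<And>j. 1 \<le> j \<Longrightarrow> j \<le> x \<Longrightarrow> 0 < u j \<and> u j < 1"
  shows "right_prob u x * hitting_time u (x + 1) + (1 - right_prob u x) * hitting_time u (x - 1)
    = hitting_time u x + 1"
proof (cases x)
  case 0
  then show ?thesis by (simp add: right_prob_def hitting_time_def crossing_time_def odds_prod_def)
next
  case (Suc y)
  have "u (Suc y) * crossing_time u (Suc y) = 1 + (1 - u (Suc y)) * crossing_time u y"
    using assms Suc by (intro crossing_time_Suc) auto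
  then show ?thesis using Suc by (simp add: right_prob_def hitting_time_def algebra_simps)
qed

context
  fixes u :: "nat \<Rightarrow> real" and N :: nat
  assumes u: "\<And>j. 1 \<le> j \<Longrightarrow> j < N \<Longrightarrow> 0 < u j \<and> u j < 1"
begin

lemma crossing_time_ge_1:
  assumes "x < N" shows "1 \<le> crossing_time u x"
  using sum_odds_prod_ratio_ge_1[of x u] u assms by (simp add: crossing_time_def)

lemma hitting_time_mono:
  assumes "x \<le> y" "y \<le> N" shows "hitting_time u x \<le> hitting_time u y"
  unfolding hitting_time_def
  using crossing_time_ge_1 assms by (intro sum_mono2) (auto intro: order_trans[of 0 1])

lemma right_prob_bounds: "x < N \<Longrightarrow> 0 \<le> right_prob u x \<and> right_prob u x \<le> 1"
  using u[of x] by (auto simp: right_prob_def)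

lemma hit_prob_bounds: "0 \<le> hit_prob u N n x \<and> hit_prob u N n x \<le> 1"
proof (induction n arbitrary: x)
  case (Suc n)
  show ?case
  proof (cases "N \<le> x")
    case False
    then have r: "0 \<le> right_prob u x" "right_prob u x \<le> 1" using right_prob_bounds[of x] by auto
    show ?thesis using False r Suc.IH[of "x + 1"] Suc.IH[of "x - 1"]
      by (auto intro!: convex_bound_le)
  qed auto
qed auto

text \<open>
  Optional stopping at the minimum of \<open>n\<close> and the hitting time of \<open>N\<close>, carried out as an induction
  on \<open>n\<close>: the mean of \<open>hitting_time u\<close> at the stopped position exceeds its starting value by the
  mean stopped time, which is at most \<open>n\<close>, and the event that \<open>N\<close> is reached contributes its
  probability times \<open>hitting_time u N\<close> to this mean.
\<close>

lemma hit_prob_le_aux: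
  assumes "x \<le> N"
  shows "hit_prob u N n x * hitting_time u N \<le> n + hitting_time u x"
  using assms
proof (induction n arbitrary: x)
  case 0
  then show ?case using hitting_time_mono[of 0 x]
    by (auto simp: hitting_time_def)
next
  case (Suc n)
  show ?case
  proof (cases "N \<le> x")
    case True
    with Suc.prems show ?thesis by simp
  next
    case False
    then have r: "0 \<le> right_prob u x" "right_prob u x \<le> 1" using right_prob_bounds[of x] by auto
    have "hit_prob u N (Suc n) x * hitting_time u N
        = right_prob u x * (hit_prob u N n (x + 1) * hitting_time u N)
        + (1 - right_prob u x) * (hit_prob u N n (x - 1) * hitting_time u N)"
      using False by (simp add: algebra_simps)
    also have "\<dots> \<le> right_prob u x * (n + hitting_time u (x + 1))
        + (1 - right_prob u x) * (n + hitting_time u (x - 1))"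
      using False r by (intro add_mono mult_left_mono Suc.IH) auto
    also have "\<dots> = n + (right_prob u x * hitting_time u (x + 1)
        + (1 - right_prob u x) * hitting_time u (x - 1))"
      by (simp add: algebra_simps)
    also have "\<dots> = n + (hitting_time u x + 1)"
      using False u by (subst hitting_time_generator) auto
    finally show ?thesis by simp
  qed
qed

text \<open>
  The reverse use of the same martingale: the stopped time is \<open>n\<close> on the event that \<open>N\<close> is not
  reached, and \<open>hitting_time u\<close> at the stopped position is at most \<open>hitting_time u N\<close>.
\<close>

lemma not_hit_prob_le_aux:
  assumes "x \<le> N"
  shows "n * (1 - hit_prob u N n x) \<le> hitting_time u N - hitting_time u x"
  using assms
proof (induction n arbitrary: x)
  case 0
  then show ?case using hitting_time_mono[of x N] by simp
next
  case (Suc n)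
  show ?case
  proof (cases "N \<le> x")
    case True
    with Suc.prems show ?thesis by simp
  next
    case False
    then have r: "0 \<le> right_prob u x" "right_prob u x \<le> 1" using right_prob_bounds[of x] by auto
    have h: "hit_prob u N (Suc n) x \<ge> 0" using hit_prob_bounds by blast
    have "n * (1 - hit_prob u N (Suc n) x)
        = right_prob u x * (n * (1 - hit_prob u N n (x + 1)))
        + (1 - right_prob u x) * (n * (1 - hit_prob u N n (x - 1)))"
      using False by (simp add: algebra_simps)
    also have "\<dots> \<le> right_prob u x * (hitting_time u N - hitting_time u (x + 1))
        + (1 - right_prob u x) * (hitting_time u N - hitting_time u (x - 1))"
      using False r by (intro add_mono mult_left_mono Suc.IH) auto
    also have "\<dots> = hitting_time u N - (right_prob u x * hitting_time u (x + 1)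
        + (1 - right_prob u x) * hitting_time u (x - 1))"
      by (simp add: algebra_simps)
    also have "\<dots> = hitting_time u N - (hitting_time u x + 1)"
      using False u by (subst hitting_time_generator) auto
    finally show ?thesis using h by (simp add: algebra_simps)
  qed
qed

lemma hit_prob_le: "hit_prob u N n 0 * hitting_time u N \<le> n"
  using hit_prob_le_aux[of 0 n] by (simp add: hitting_time_def)

lemma not_hit_prob_le: "n * (1 - hit_prob u N n 0) \<le> hitting_time u N"
  using not_hit_prob_le_aux[of 0 n] by (simp add: hitting_time_def)

end

section \<open>A maximal inequality for products of independent factors\<close>

fun stopped_prod :: "real \<Rightarrow> (nat \<Rightarrow> real \<Rightarrow> real) \<Rightarrow> nat \<Rightarrow> (nat \<Rightarrow> real) \<Rightarrow> real" where
  "stopped_prod c Z 0 v = 1"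
| "stopped_prod c Z (Suc n) v =
     stopped_prod c Z n v * (if c \<le> stopped_prod c Z n v then 1 else Z (Suc n) (v (Suc n)))"

lemma stopped_prod_eq:
  "(\<exists>x\<le>n. c \<le> (\<Prod>j\<in>{1..x}. Z j (v j))) \<and> c \<le> stopped_prod c Z n v \<or>
   \<not> (\<exists>x\<le>n. c \<le> (\<Prod>j\<in>{1..x}. Z j (v j))) \<and> stopped_prod c Z n v = (\<Prod>j\<in>{1..n}. Z j (v j))"
proof (induction n)
  case (Suc n)
  then show ?case by (auto simp: le_Suc_eq)
qed auto

lemma stopped_prod_nonneg:
  "(\<And>j t. 0 \<le> Z j t) \<Longrightarrow> 0 \<le> stopped_prod c Z n v"
  by (induction n) auto

lemma stopped_prod_cong:
  "(\<And>j. j \<in> {1..n} \<Longrightarrow> v j = w j) \<Longrightarrow> stopped_prod c Z n v = stopped_prod c Z n w"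
  by (induction n) auto

lemma measurable_stopped_prod:
  fixes B :: "nat \<Rightarrow> real measure"
  assumes "\<And>j. sets (B j) = sets borel" "\<And>j. Z j \<in> borel_measurable borel" "{1..n} \<subseteq> I"
  shows "stopped_prod c Z n \<in> borel_measurable (PiM I B)"
  using assms(3)
proof (induction n)
  case (Suc n)
  have [measurable]: "stopped_prod c Z n \<in> borel_measurable (PiM I B)"
    using Suc.prems by (intro Suc.IH) auto
  have "(\<lambda>v. v (Suc n)) \<in> measurable (PiM I B) (B (Suc n))"
    using Suc.prems by (intro measurable_component_singleton) auto
  then have "(\<lambda>v. v (Suc n)) \<in> borel_measurable (PiM I B)"
    using assms(1) measurable_cong_sets by blast
  then have [measurable]: "(\<lambda>v. Z (Suc n) (v (Suc n))) \<in> borel_measurable (PiM I B)"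
    using assms(2) by (rule measurable_compose)
  show ?case by (simp del: measurable_If_set) measurable
qed (simp add: stopped_prod.simps(1)[abs_def])

lemma nn_integral_stopped_prod_le_1:
  fixes B :: "nat \<Rightarrow> real measure"
  assumes B: "\<And>j. prob_space (B j)" and S: "\<And>j. sets (B j) = sets borel"
    and Z: "\<And>j. Z j \<in> borel_measurable borel" and Z0: "\<And>j t. 0 \<le> Z j t"
    and E: "\<And>j. 1 \<le> j \<Longrightarrow> (\<integral>\<^sup>+t. ennreal (Z j t) \<partial>B j) \<le> 1"
  shows "(\<integral>\<^sup>+v. ennreal (stopped_prod c Z n v) \<partial>PiM {1..n} B) \<le> 1"
proof (induction n)
  case 0
  show ?case by (simp add: PiM_empty)
next
  case (Suc n)
  interpret product_prob_space B "{1..Suc n}"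
    unfolding product_prob_space_def product_prob_space_axioms_def product_sigma_finite_def
    using B by (auto intro: prob_space_imp_sigma_finite)
  have I: "insert (Suc n) {1..n} = {1..Suc n}" by auto
  note Z[measurable] S[measurable_cong]
  have "(\<integral>\<^sup>+v. ennreal (stopped_prod c Z (Suc n) v) \<partial>PiM {1..Suc n} B)
      = (\<integral>\<^sup>+v. \<integral>\<^sup>+t. ennreal (stopped_prod c Z (Suc n) (v(Suc n := t))) \<partial>B (Suc n) \<partial>PiM {1..n} B)"
    unfolding I[symmetric]
    by (rule product_nn_integral_insert)
       (simp_all only: I finite_atLeastAtMost measurable_compose[OF
          measurable_stopped_prod[OF S Z order_refl] measurable_ennreal], simp)
  also have "\<dots> \<le> (\<integral>\<^sup>+v. ennreal (stopped_prod c Z n v) \<partial>PiM {1..n} B)"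
  proof (rule nn_integral_mono)
    fix v
    have c: "stopped_prod c Z n (v(Suc n := t)) = stopped_prod c Z n v" for t
      by (rule stopped_prod_cong) auto
    show "(\<integral>\<^sup>+t. ennreal (stopped_prod c Z (Suc n) (v(Suc n := t))) \<partial>B (Suc n))
      \<le> ennreal (stopped_prod c Z n v)"
    proof (cases "c \<le> stopped_prod c Z n v")
      case True
      then show ?thesis by (simp add: c prob_space.emeasure_space_1[OF B])
    next
      case False
      have "(\<integral>\<^sup>+t. ennreal (stopped_prod c Z n v * Z (Suc n) t) \<partial>B (Suc n))
          = ennreal (stopped_prod c Z n v) * (\<integral>\<^sup>+t. ennreal (Z (Suc n) t) \<partial>B (Suc n))"
        by (subst nn_integral_cmult[symmetric])
           (auto simp: ennreal_mult Z0 stopped_prod_nonneg)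
      also have "\<dots> \<le> ennreal (stopped_prod c Z n v) * 1"
        by (intro mult_left_mono E) auto
      finally show ?thesis using False by (simp add: c)
    qed
  qed
  finally show ?case using Suc.IH by (rule order_trans)
qed

text \<open>
  Doob's maximal inequality for the supermartingale of partial products. Freezing the product at level
  \<open>c\<close> keeps its mean at most one, and the Markov inequality applies to the frozen product.
\<close>

lemma prod_maximal_inequality:
  fixes B :: "nat \<Rightarrow> real measure"
  assumes B: "\<And>j. prob_space (B j)" and S: "\<And>j. sets (B j) = sets borel"
    and Z: "\<And>j. Z j \<in> borel_measurable borel" and Z0: "\<And>j t. 0 \<le> Z j t"
    and E: "\<And>j. 1 \<le> j \<Longrightarrow> (\<integral>\<^sup>+t. ennreal (Z j t) \<partial>B j) \<le> 1"
    and c: "c > 0"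
  shows "emeasure (PiM {1..n} B) {v \<in> space (PiM {1..n} B). \<exists>x\<le>n. c \<le> (\<Prod>j\<in>{1..x}. Z j (v j))}
    \<le> ennreal (1 / c)"
proof -
  let ?P = "PiM {1..n} B"
  have M: "(\<lambda>v. ennreal (stopped_prod c Z n v)) \<in> borel_measurable ?P"
    using measurable_stopped_prod[OF S Z, of n "{1..n}" c] by auto
  have "emeasure ?P {v \<in> space ?P. \<exists>x\<le>n. c \<le> (\<Prod>j\<in>{1..x}. Z j (v j))}
    \<le> emeasure ?P {v \<in> space ?P. 1 \<le> ennreal (1 / c) * ennreal (stopped_prod c Z n v)}"
  proof (rule emeasure_mono)
    show "{v \<in> space ?P. \<exists>x\<le>n. c \<le> (\<Prod>j\<in>{1..x}. Z j (v j))}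
      \<subseteq> {v \<in> space ?P. 1 \<le> ennreal (1 / c) * ennreal (stopped_prod c Z n v)}"
    proof safe
      fix v x assume "x \<le> n" "c \<le> (\<Prod>j\<in>{1..x}. Z j (v j))"
      then have "c \<le> stopped_prod c Z n v" using stopped_prod_eq[of n c Z v] by blast
      then show "1 \<le> ennreal (1 / c) * ennreal (stopped_prod c Z n v)"
        using c by (simp add: ennreal_mult[symmetric] stopped_prod_nonneg Z0 field_simps)
    qed
  qed (use M in measurable)
  also have "\<dots> \<le> ennreal (1 / c) * (\<integral>\<^sup>+v. ennreal (stopped_prod c Z n v) * indicator (space ?P) v \<partial>?P)"
    using M by (intro nn_integral_Markov_inequality) auto
  also have "(\<integral>\<^sup>+v. ennreal (stopped_prod c Z n v) * indicator (space ?P) v \<partial>?P)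
      = (\<integral>\<^sup>+v. ennreal (stopped_prod c Z n v) \<partial>?P)"
    by (rule nn_integral_cong) auto
  also have "ennreal (1 / c) * \<dots> \<le> ennreal (1 / c) * 1"
    by (intro mult_left_mono nn_integral_stopped_prod_le_1 assms) auto
  finally show ?thesis by simp
qed


section \<open>The reinforced walk as a mixture over environments\<close>

text \<open>
  The law of the biases of the vertices \<open>1, \<dots>, n\<close>, which are all that matters until the walk
  reaches \<open>n + 1\<close>. The term \<open>\<Delta>\<close> in the second parameter is the reinforcement of the left edge by the
  first arrival at \<open>x\<close>.
\<close>

definition env :: "(nat \<Rightarrow> real) \<Rightarrow> real \<Rightarrow> nat \<Rightarrow> (nat \<Rightarrow> real) measure" where
  "env f \<Delta> n = PiM {1..n} (\<lambda>x. beta_law (f x / (2 * \<Delta>)) ((f (x - 1) + \<Delta>) / (2 * \<Delta>)))"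

definition right_steps :: "(nat \<Rightarrow> nat) \<Rightarrow> nat \<Rightarrow> nat \<Rightarrow> nat" where
  "right_steps p m x = card {i\<in>{1..m}. p (i - 1) = x \<and> p i = x + 1}"

definition left_steps :: "(nat \<Rightarrow> nat) \<Rightarrow> nat \<Rightarrow> nat \<Rightarrow> nat" where
  "left_steps p m x = card {i\<in>{1..m}. p (i - 1) = x \<and> p i + 1 = x}"

definition nn_path :: "(nat \<Rightarrow> nat) \<Rightarrow> nat \<Rightarrow> bool" where
  "nn_path p m \<longleftrightarrow> p 0 = 0 \<and> (\<forall>i<m. p (Suc i) = p i + 1 \<or> p (Suc i) + 1 = p i)"

text \<open>
  The probability that the walk in the environment \<open>u\<close> follows the first \<open>m\<close> steps of a
  nearest-neighbour path \<open>p\<close> that stays in \<open>{0..n}\<close> before time \<open>m\<close>; steps from the origin are certain.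
\<close>

definition path_weight :: "(nat \<Rightarrow> real) \<Rightarrow> nat \<Rightarrow> (nat \<Rightarrow> nat) \<Rightarrow> nat \<Rightarrow> real" where
  "path_weight u n p m =
     (\<Prod>x\<in>{1..n}. u x ^ right_steps p m x * (1 - u x) ^ left_steps p m x)"

lemma nn_path_extend:
  assumes "nn_path p m" "y = p m + 1 \<or> y + 1 = p m"
  shows "nn_path (p(Suc m := y)) (Suc m)"
  unfolding nn_path_def
proof (intro conjI allI impI)
  fix i assume "i < Suc m"
  then show "(p(Suc m := y)) (Suc i) = (p(Suc m := y)) i + 1 \<or> (p(Suc m := y)) (Suc i) + 1 = (p(Suc m := y)) i"
    using assms by (cases "i = m") (simp_all add: nn_path_def)
qed (use assms in \<open>simp add: nn_path_def\<close>)

lemma card_filter_Suc: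
  "card {i\<in>{1..Suc m}. P i} = card {i\<in>{1..m}. P i} + of_bool (P (Suc m))"
proof -
  have "{i\<in>{1..Suc m}. P i} = {i\<in>{1..m}. P i} \<union> (if P (Suc m) then {Suc m} else {})"
    by (auto simp: le_Suc_eq)
  then show ?thesis by (simp add: card_insert_if)
qed

lemma right_steps_Suc:
  "right_steps p (Suc m) x = right_steps p m x + of_bool (p m = x \<and> p (Suc m) = x + 1)"
  unfolding right_steps_def by (subst card_filter_Suc) simp

lemma left_steps_Suc:
  "left_steps p (Suc m) x = left_steps p m x + of_bool (p m = x \<and> p (Suc m) + 1 = x)"
  unfolding left_steps_def by (subst card_filter_Suc) simp

lemma steps_0 [simp]: "right_steps p 0 x = 0" "left_steps p 0 x = 0"
  by (simp_all add: right_steps_def left_steps_def)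

lemma edge_traversals_eq: "edge_traversals p m x = right_steps p m x + left_steps p m (x + 1)"
proof (induction m)
  case 0
  then show ?case by (simp add: edge_traversals_def)
next
  case (Suc m)
  have "edge_traversals p (Suc m) x
      = edge_traversals p m x + of_bool ({p m, p (Suc m)} = {x, x + 1})"
    unfolding edge_traversals_def by (subst card_filter_Suc) simp
  moreover have "{p m, p (Suc m)} = {x, x + 1} \<longleftrightarrow>
      p m = x \<and> p (Suc m) = x + 1 \<or> p m = x + 1 \<and> p (Suc m) + 1 = x + 1"
    by (auto simp: doubleton_eq_iff)
  ultimately show ?case
    by (auto simp: Suc right_steps_Suc left_steps_Suc)
qed

text \<open>
  A path from \<open>0\<close> crosses an edge alternately to the right and to the left. This parity is why the
  weights seen by the walk at \<open>x\<close> depend only on the past decisions at \<open>x\<close> itself.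
\<close>

lemma right_steps_balance:
  "nn_path p m \<Longrightarrow> right_steps p m x = left_steps p m (x + 1) + of_bool (x < p m)"
proof (induction m)
  case 0
  then show ?case by (simp add: nn_path_def)
next
  case (Suc m)
  have IH: "right_steps p m x = left_steps p m (x + 1) + of_bool (x < p m)"
    using Suc by (simp add: nn_path_def)
  have "p (Suc m) = p m + 1 \<or> p (Suc m) + 1 = p m" using Suc.prems by (simp add: nn_path_def)
  then show ?case
    unfolding right_steps_Suc left_steps_Suc IH by auto
qed

lemma steps_cong:
  assumes "\<And>i. i \<le> m \<Longrightarrow> p i = q i"
  shows "right_steps p m x = right_steps q m x" "left_steps p m x = left_steps q m x"
proof -
  have "p (i - 1) = q (i - 1) \<and> p i = q i" if "i \<in> {1..m}" for i using that assms by auto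
  then show "right_steps p m x = right_steps q m x" "left_steps p m x = left_steps q m x"
    unfolding right_steps_def left_steps_def by (metis (mono_tags, lifting))+
qed

lemma path_weight_cong:
  assumes "\<And>i. i \<le> m \<Longrightarrow> p i = q i"
  shows "path_weight u n p m = path_weight u n q m"
  unfolding path_weight_def using steps_cong[of m p q, OF assms] by simp

lemma path_weight_right:
  assumes "p (Suc m) = p m + 1" "p m \<le> n"
  shows "path_weight u n p (Suc m) = path_weight u n p m * right_prob u (p m)"
proof -
  have "path_weight u n p (Suc m) =
    (\<Prod>x\<in>{1..n}. (u x ^ right_steps p m x * (1 - u x) ^ left_steps p m x) * (if x = p m then u x else 1))"
    unfolding path_weight_def using assms
    by (intro prod.cong) (auto simp: right_steps_Suc left_steps_Suc)
  also have "\<dots> = path_weight u n p m * (\<Prod>x\<in>{1..n}. if x = p m then u x else 1)"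
    by (simp only: path_weight_def prod.distrib)
  also have "(\<Prod>x\<in>{1..n}. if x = p m then u x else 1) = right_prob u (p m)"
    using assms by (subst prod.delta) (auto simp: right_prob_def)
  finally show ?thesis .
qed

lemma path_weight_left:
  assumes "p (Suc m) + 1 = p m" "p m \<le> n"
  shows "path_weight u n p (Suc m) = path_weight u n p m * (1 - right_prob u (p m))"
proof -
  have "path_weight u n p (Suc m) =
    (\<Prod>x\<in>{1..n}. (u x ^ right_steps p m x * (1 - u x) ^ left_steps p m x) * (if x = p m then 1 - u x else 1))"
    unfolding path_weight_def using assms
    by (intro prod.cong) (auto simp: right_steps_Suc left_steps_Suc)
  also have "\<dots> = path_weight u n p m * (\<Prod>x\<in>{1..n}. if x = p m then 1 - u x else 1)"
    by (simp only: path_weight_def prod.distrib)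
  also have "(\<Prod>x\<in>{1..n}. if x = p m then 1 - u x else 1) = 1 - right_prob u (p m)"
    using assms by (subst prod.delta) (auto simp: right_prob_def)
  finally show ?thesis .
qed

lemma step_right_prob_cong:
  assumes "\<And>i. i \<le> m \<Longrightarrow> p i = q i"
  shows "step_right_prob f \<Delta> p m = step_right_prob f \<Delta> q m"
  using assms[of m] steps_cong[of m p q, OF assms]
  by (simp add: step_right_prob_def edge_weight_def edge_traversals_eq)

text \<open>
  The transition rule in urn form: the composition of the urn at the current vertex is given by the
  two Beta parameters increased by the numbers of past departures from it to the right and to the left.
\<close>

lemma step_right_prob_eq:
  fixes f :: "nat \<Rightarrow> real"
  assumes f: "\<And>x. f x > 0" and \<Delta>: "\<Delta> > 0" and p: "nn_path p m"
  defines "A \<equiv> f (p m) / (2 * \<Delta>) + right_steps p m (p m)"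
    and "B \<equiv> (f (p m - 1) + \<Delta>) / (2 * \<Delta>) + left_steps p m (p m)"
  shows "step_right_prob f \<Delta> p m = (if p m = 0 then 1 else A / (A + B))"
proof -
  define x where "x = p m"
  have r: "edge_weight f \<Delta> p m (int x) = 2 * \<Delta> * A"
    using right_steps_balance[OF p, of x] \<Delta>
    by (simp add: edge_weight_def edge_traversals_eq A_def x_def field_simps)
  have A: "A > 0" using f \<Delta> by (simp add: A_def add_pos_nonneg)
  have B: "B > 0" using f[of "p m - 1"] \<Delta> by (simp add: B_def add_pos_nonneg)
  show ?thesis
  proof (cases "x = 0")
    case True
    then show ?thesis using r A \<Delta> by (simp add: step_right_prob_def x_def edge_weight_def)
  next
    case False
    then have x: "nat (int x - 1) = x - 1" "x - 1 + 1 = x" "x - 1 < p m" "\<not> int x - 1 < 0"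
      by (auto simp: x_def)
    have l: "edge_weight f \<Delta> p m (int x - 1) = 2 * \<Delta> * B"
      using right_steps_balance[OF p, of "x - 1"] \<Delta> x
      by (simp add: edge_weight_def edge_traversals_eq B_def x_def field_simps)
    have "step_right_prob f \<Delta> p m = 2 * \<Delta> * A / (2 * \<Delta> * B + 2 * \<Delta> * A)"
      using r l by (simp add: step_right_prob_def x_def)
    also have "\<dots> = (2 * \<Delta> * A) / (2 * \<Delta> * (A + B))" by (simp add: algebra_simps)
    also have "\<dots> = A / (A + B)" using \<Delta> by simp
    finally show ?thesis using False by (simp add: x_def)
  qed
qed

text \<open>
  The probability that independent Polya urns at the vertices produce the steps of \<open>p\<close>, written
  as the mean of \<open>path_weight\<close> over the environment.
\<close>

definition urn_weight :: "(nat \<Rightarrow> real) \<Rightarrow> real \<Rightarrow> nat \<Rightarrow> (nat \<Rightarrow> nat) \<Rightarrow> nat \<Rightarrow> real" where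
  "urn_weight f \<Delta> n p m = (\<Prod>x\<in>{1..n}.
     Beta (f x / (2 * \<Delta>) + right_steps p m x) ((f (x - 1) + \<Delta>) / (2 * \<Delta>) + left_steps p m x)
     / Beta (f x / (2 * \<Delta>)) ((f (x - 1) + \<Delta>) / (2 * \<Delta>)))"

text \<open>
  One more step changes a single Beta quotient, and \<open>B(A + 1, B) = A / (A + B) B(A, B)\<close> turns
  this change into the transition probability.
\<close>

lemma urn_weight_Suc:
  assumes f: "\<And>x. f x > 0" and \<Delta>: "\<Delta> > 0" and p: "nn_path p (Suc m)" and n: "p m \<le> n"
  shows "urn_weight f \<Delta> n p (Suc m) = urn_weight f \<Delta> n p m *
    (if p (Suc m) = p m + 1 then step_right_prob f \<Delta> p m else 1 - step_right_prob f \<Delta> p m)"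
proof -
  have p': "nn_path p m" and s: "p (Suc m) = p m + 1 \<or> p (Suc m) + 1 = p m"
    using p by (auto simp: nn_path_def)
  define a where "a x = f x / (2 * \<Delta>)" for x
  define b where "b x = (f (x - 1) + \<Delta>) / (2 * \<Delta>)" for x :: nat
  define F where "F k x = Beta (a x + right_steps p k x) (b x + left_steps p k x) / Beta (a x) (b x)" for k x
  have pos: "a x > 0" "b x > 0" for x using f[of x] f[of "x - 1"] \<Delta> by (auto simp: a_def b_def)
  have u: "urn_weight f \<Delta> n p k = (\<Prod>x\<in>{1..n}. F k x)" for k
    by (simp add: urn_weight_def F_def a_def b_def)
  have other: "F (Suc m) x = F m x" if "x \<noteq> p m" for x
    using that by (simp add: F_def right_steps_Suc left_steps_Suc)
  show ?thesis
  proof (cases "p m = 0")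
    case True
    then have "urn_weight f \<Delta> n p (Suc m) = urn_weight f \<Delta> n p m"
      unfolding u using other by (intro prod.cong) auto
    then show ?thesis using True s step_right_prob_eq[OF f \<Delta> p'] by simp
  next
    case False
    define A where "A = a (p m) + right_steps p m (p m)"
    define B where "B = b (p m) + left_steps p m (p m)"
    have AB: "A > 0" "B > 0" using pos by (simp_all add: A_def B_def add_pos_nonneg)
    have ni: "A \<notin> \<int>\<^sub>\<le>\<^sub>0" "B \<notin> \<int>\<^sub>\<le>\<^sub>0" "A + B \<notin> \<int>\<^sub>\<le>\<^sub>0"
      using AB by (auto elim!: nonpos_Ints_cases)
    have srp: "step_right_prob f \<Delta> p m = A / (A + B)"
      using step_right_prob_eq[OF f \<Delta> p'] False by (simp add: A_def B_def a_def b_def)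
    have B1: "Beta (A + 1) B = A / (A + B) * Beta A B" "Beta A (B + 1) = B / (A + B) * Beta A B"
      using Beta_plus1_left[of A B] Beta_plus1_right[of B A] ni AB by (simp_all add: field_simps)
    have at: "F (Suc m) (p m) = F m (p m) *
      (if p (Suc m) = p m + 1 then step_right_prob f \<Delta> p m else 1 - step_right_prob f \<Delta> p m)"
    proof (cases "p (Suc m) = p m + 1")
      case True
      then have "F (Suc m) (p m) = Beta (A + 1) B / Beta (a (p m)) (b (p m))"
        by (simp add: F_def right_steps_Suc left_steps_Suc A_def B_def add_ac)
      then show ?thesis unfolding B1 srp using True by (simp add: F_def A_def B_def mult_ac)
    next
      case False
      then have "F (Suc m) (p m) = Beta A (B + 1) / Beta (a (p m)) (b (p m))"
        using s by (simp add: F_def right_steps_Suc left_steps_Suc A_def B_def add_ac)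
      moreover have "1 - A / (A + B) = B / (A + B)" using AB by (simp add: field_simps)
      ultimately show ?thesis unfolding B1 srp using False by (simp add: F_def A_def B_def mult_ac)
    qed
    have "p m \<in> {1..n}" using False n by auto
    then have "urn_weight f \<Delta> n p k = F k (p m) * (\<Prod>x\<in>{1..n} - {p m}. F k x)" for k
      unfolding u by (intro prod.remove) auto
    moreover have "(\<Prod>x\<in>{1..n} - {p m}. F (Suc m) x) = (\<Prod>x\<in>{1..n} - {p m}. F m x)"
      using other by (intro prod.cong) auto
    ultimately show ?thesis using at by simp
  qed
qed

lemma measurable_env_component:
  "x \<in> {1..n} \<Longrightarrow> (\<lambda>u. u x) \<in> borel_measurable (env f \<Delta> n)"
  unfolding env_def
  using measurable_component_singleton[of x "{1..n}"
      "\<lambda>x. beta_law (f x / (2 * \<Delta>)) ((f (x - 1) + \<Delta>) / (2 * \<Delta>))"]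
  by (simp add: measurable_cong_sets[OF refl sets_beta_law])

lemma measurable_hit_prob:
  "(\<lambda>u. hit_prob u (Suc n) k x) \<in> borel_measurable (env f \<Delta> n)"
proof (induction k arbitrary: x)
  case (Suc k)
  note Suc[measurable]
  have [measurable]: "(\<lambda>u. right_prob u x) \<in> borel_measurable (env f \<Delta> n)" if "x \<le> n"
    using that measurable_env_component[of x n] by (cases "x = 0") (auto simp: right_prob_def)
  show ?case by (cases "Suc n \<le> x") (simp_all)
qed auto

lemma measurable_path_weight:
  "(\<lambda>u. path_weight u n p m) \<in> borel_measurable (env f \<Delta> n)"
  unfolding path_weight_def
  by (intro borel_measurable_prod borel_measurable_times borel_measurable_power
      borel_measurable_diff borel_measurable_const measurable_env_component)

context
  fixes f :: "nat \<Rightarrow> real" and \<Delta> :: real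
  assumes f: "\<And>x. f x > 0" and \<Delta>: "\<Delta> > 0"
begin

lemma prob_space_env_factor: "prob_space (beta_law (f x / (2 * \<Delta>)) ((f (x - 1) + \<Delta>) / (2 * \<Delta>)))"
  using f[of x] f[of "x - 1"] \<Delta> by (intro prob_space_beta_law) auto

lemma prob_space_env: "prob_space (env f \<Delta> n)"
  unfolding env_def by (intro prob_space_PiM prob_space_env_factor)

lemma AE_env: "AE u in env f \<Delta> n. \<forall>x\<in>{1..n}. 0 < u x \<and> u x < 1"
  unfolding env_def
  by (intro AE_finite_allI AE_PiM_component[where P = "\<lambda>t. 0 < t \<and> t < 1"]
      prob_space_env_factor AE_beta_law) auto

lemma nn_integral_path_weight:
  "(\<integral>\<^sup>+u. ennreal (path_weight u n p m) \<partial>env f \<Delta> n) = ennreal (urn_weight f \<Delta> n p m)"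
proof -
  let ?a = "\<lambda>x. f x / (2 * \<Delta>)" and ?b = "\<lambda>x. (f (x - 1) + \<Delta>) / (2 * \<Delta>)"
  let ?r = "right_steps p m" and ?l = "left_steps p m"
  interpret product_sigma_finite "\<lambda>x. beta_law (?a x) (?b x)"
    using prob_space_env_factor by (simp add: product_sigma_finite_def prob_space_imp_sigma_finite)
  have ab: "?a x > 0" "?b x > 0" for x using f[of x] f[of "x - 1"] \<Delta> by auto
  have "(\<integral>\<^sup>+u. ennreal (path_weight u n p m) \<partial>env f \<Delta> n)
      = (\<integral>\<^sup>+u. (\<Prod>x\<in>{1..n}. ennreal (u x powr ?r x * (1 - u x) powr ?l x)) \<partial>env f \<Delta> n)"
    by (rule nn_integral_cong_AE)
       (use AE_env in \<open>eventually_elim, subst prod_ennreal,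
          auto simp: path_weight_def powr_realpow less_imp_le
            intro!: arg_cong[where f = ennreal] prod.cong\<close>)
  also have "\<dots> = (\<Prod>x\<in>{1..n}. \<integral>\<^sup>+t. ennreal (t powr ?r x * (1 - t) powr ?l x)
      \<partial>beta_law (?a x) (?b x))"
    unfolding env_def by (rule product_nn_integral_prod) auto
  also have "\<dots> = (\<Prod>x\<in>{1..n}. ennreal (Beta (?a x + ?r x) (?b x + ?l x) / Beta (?a x) (?b x)))"
    using ab by (intro prod.cong nn_integral_beta_law refl) (auto intro: add_pos_nonneg)
  also have "\<dots> = ennreal (urn_weight f \<Delta> n p m)"
    unfolding urn_weight_def using ab
    by (intro prod_ennreal divide_nonneg_nonneg less_imp_le[OF Beta_real_pos])
       (auto intro: add_pos_nonneg)
  finally show ?thesis .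
qed

end

context lerrw
begin

lemma X_measurable [measurable]: "X n \<in> measurable M (count_space UNIV)"
  by (rule measurable_X)

definition follows :: "(nat \<Rightarrow> nat) \<Rightarrow> nat \<Rightarrow> 'a set" where
  "follows p m = {\<omega> \<in> space M. \<forall>i\<le>m. X i \<omega> = p i}"

lemma follows_measurable [measurable]: "follows p m \<in> sets M"
  unfolding follows_def by measurable

lemma space_past [simp]: "space (past M X n) = space M"
  unfolding past_def by (rule space_measure_of) auto

lemma sets_past: "sets (past M X n) = sigma_sets (space M) {X i -` A \<inter> space M | i A. i \<le> n}"
  unfolding past_def by (rule sets_measure_of) auto

lemma subalgebra_past: "subalgebra M (past M X n)"
  unfolding subalgebra_def sets_past space_past
proof (intro conjI refl sets.sigma_sets_subset subsetI)
  fix S assume "S \<in> {X i -` A \<inter> space M | i A. i \<le> n}"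
  then show "S \<in> sets M" using measurable_sets[OF X_measurable] by auto
qed

lemma follows_in_past: "follows p m \<in> sets (past M X m)"
proof -
  have "X i -` {p i} \<inter> space M \<in> sets (past M X m)" if "i \<le> m" for i
    unfolding sets_past using that by (intro sigma_sets.Basic) auto
  then have "(\<Inter>i\<in>{..m}. X i -` {p i} \<inter> space M) \<in> sets (past M X m)"
    by (intro sets.finite_INT) auto
  also have "(\<Inter>i\<in>{..m}. X i -` {p i} \<inter> space M) = follows p m"
    by (auto simp: follows_def)
  finally show ?thesis .
qed

text \<open>
  The defining property of conditional expectations on the event that the walk has followed \<open>p\<close>,
  on which the conditional probability is the constant \<open>r p\<close>.
\<close>

lemma prob_follows_step_aux:
  assumes S [measurable]: "{\<omega> \<in> space M. S \<omega>} \<in> sets M"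
    and c: "AE \<omega> in M. real_cond_exp M (past M X m) (indicator {\<omega> \<in> space M. S \<omega>}) \<omega> = r (\<lambda>i. X i \<omega>)"
    and r: "\<And>q. (\<And>i. i \<le> m \<Longrightarrow> q i = p i) \<Longrightarrow> r q = r p"
  shows "prob {\<omega> \<in> follows p m. S \<omega>} = prob (follows p m) * r p"
proof -
  interpret finite_measure_subalgebra M "past M X m"
    by unfold_locales (rule subalgebra_past)
  let ?E = "follows p m" and ?f = "indicator {\<omega> \<in> space M. S \<omega>} :: 'a \<Rightarrow> real"
  have E: "{\<omega> \<in> follows p m. S \<omega>} = ?E \<inter> {\<omega> \<in> space M. S \<omega>}" by (auto simp: follows_def)
  have "prob {\<omega> \<in> follows p m. S \<omega>} = (\<integral>\<omega>. indicator (?E \<inter> {\<omega> \<in> space M. S \<omega>}) \<omega> \<partial>M)"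
    unfolding E by (subst Bochner_Integration.integral_indicator) (auto simp: follows_def intro!: arg_cong[where f = prob])
  also have "\<dots> = (\<integral>\<omega>\<in>?E. ?f \<omega> \<partial>M)"
    by (simp add: set_lebesgue_integral_def indicator_inter_arith)
  also have "\<dots> = (\<integral>\<omega>\<in>?E. real_cond_exp M (past M X m) ?f \<omega> \<partial>M)"
    by (rule real_cond_exp_intA[OF _ follows_in_past]) (simp add: integrable_real_indicator less_top[symmetric])
  also have "\<dots> = (\<integral>\<omega>\<in>?E. r p \<partial>M)"
    unfolding set_lebesgue_integral_def
  proof (rule integral_cong_AE)
    show "AE \<omega> in M. indicator ?E \<omega> *\<^sub>R real_cond_exp M (past M X m) ?f \<omega> = indicator ?E \<omega> *\<^sub>R r p"
      using c
    proof eventually_elim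
      case (elim \<omega>)
      have "r (\<lambda>i. X i \<omega>) = r p" if "\<omega> \<in> ?E" using that by (intro r) (auto simp: follows_def)
      then show ?case using elim by (auto simp: indicator_def)
    qed
  qed (use follows_in_past subalgebra_past in \<open>auto intro!: borel_measurable_indicator\<close>)
  also have "\<dots> = prob ?E * r p" by (simp add: set_lebesgue_integral_def)
  finally show ?thesis .
qed

lemma step_events [measurable]:
  "{\<omega> \<in> space M. X (Suc m) \<omega> = X m \<omega> + 1} \<in> sets M"
  "{\<omega> \<in> space M. X (Suc m) \<omega> + 1 = X m \<omega>} \<in> sets M"
proof -
  have "{\<omega> \<in> space M. X (Suc m) \<omega> = X m \<omega> + 1}
      = {\<omega> \<in> space M. \<exists>k. X m \<omega> = k \<and> X (Suc m) \<omega> = k + 1}" by auto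
  also have "\<dots> \<in> sets M" by measurable
  finally show "{\<omega> \<in> space M. X (Suc m) \<omega> = X m \<omega> + 1} \<in> sets M" .
  have "{\<omega> \<in> space M. X (Suc m) \<omega> + 1 = X m \<omega>}
      = {\<omega> \<in> space M. \<exists>k. X (Suc m) \<omega> = k \<and> X m \<omega> = k + 1}" by auto
  also have "\<dots> \<in> sets M" by measurable
  finally show "{\<omega> \<in> space M. X (Suc m) \<omega> + 1 = X m \<omega>} \<in> sets M" .
qed

lemma prob_follows_right:
  "prob {\<omega> \<in> follows p m. X (Suc m) \<omega> = p m + 1} = prob (follows p m) * step_right_prob f \<Delta> p m"
proof -
  have "prob {\<omega> \<in> follows p m. X (Suc m) \<omega> = X m \<omega> + 1}
      = prob (follows p m) * step_right_prob f \<Delta> p m"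
    by (rule prob_follows_step_aux[OF step_events(1) step_right]) (rule step_right_prob_cong)
  moreover have "{\<omega> \<in> follows p m. X (Suc m) \<omega> = X m \<omega> + 1}
      = {\<omega> \<in> follows p m. X (Suc m) \<omega> = p m + 1}"
    by (auto simp: follows_def)
  ultimately show ?thesis by simp
qed

lemma prob_follows_left:
  "prob {\<omega> \<in> follows p m. X (Suc m) \<omega> + 1 = p m}
    = prob (follows p m) * (1 - step_right_prob f \<Delta> p m)"
proof -
  have "prob {\<omega> \<in> follows p m. X (Suc m) \<omega> + 1 = X m \<omega>}
      = prob (follows p m) * (1 - step_right_prob f \<Delta> p m)"
    by (rule prob_follows_step_aux[where r = "\<lambda>q. 1 - step_right_prob f \<Delta> q m", OF step_events(2) step_left])
       (rule arg_cong[where f = "\<lambda>z. 1 - z"], rule step_right_prob_cong)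
  moreover have "{\<omega> \<in> follows p m. X (Suc m) \<omega> + 1 = X m \<omega>}
      = {\<omega> \<in> follows p m. X (Suc m) \<omega> + 1 = p m}"
    by (auto simp: follows_def)
  ultimately show ?thesis by simp
qed

lemma AE_follows_step:
  "AE \<omega> in M. \<omega> \<in> follows p m \<longrightarrow> X (Suc m) \<omega> = p m + 1 \<or> X (Suc m) \<omega> + 1 = p m"
proof -
  let ?R = "{\<omega> \<in> follows p m. X (Suc m) \<omega> = p m + 1}"
  let ?L = "{\<omega> \<in> follows p m. X (Suc m) \<omega> + 1 = p m}"
  have m: "?R \<in> sets M" "?L \<in> sets M" by measurable
  have "prob (?R \<union> ?L) = prob ?R + prob ?L"
    by (rule finite_measure_Union) (use m in auto)
  also have "\<dots> = prob (follows p m)"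
    unfolding prob_follows_right prob_follows_left by (simp add: algebra_simps)
  finally have "prob (follows p m - (?R \<union> ?L)) = 0"
    using m by (subst finite_measure_Diff) auto
  then have "AE \<omega> in M. \<omega> \<notin> follows p m - (?R \<union> ?L)"
    using m by (intro AE_not_in) (auto simp: null_sets_def emeasure_eq_measure)
  then show ?thesis by eventually_elim auto
qed

context
  assumes \<Delta>_pos: "\<Delta> > 0"
begin

lemma prob_follows_eq:
  "nn_path p m \<Longrightarrow> (\<And>i. i < m \<Longrightarrow> p i \<le> n) \<Longrightarrow> prob (follows p m) = urn_weight f \<Delta> n p m"
proof (induction m)
  case 0
  then have "prob (follows p 0) = 1" using start by (simp add: follows_def nn_path_def)
  moreover have "Beta (f x / (2 * \<Delta>)) ((f (x - 1) + \<Delta>) / (2 * \<Delta>)) > 0" for x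
    using initial_weight_pos[of x] initial_weight_pos[of "x - 1"] \<Delta>_pos
    by (intro Beta_real_pos) auto
  ultimately show ?case by (simp add: urn_weight_def less_imp_neq[THEN not_sym])
next
  case (Suc m)
  have p: "nn_path p m" and s: "p (Suc m) = p m + 1 \<or> p (Suc m) + 1 = p m"
    using Suc.prems by (auto simp: nn_path_def)
  have IH: "prob (follows p m) = urn_weight f \<Delta> n p m" using p Suc by auto
  have "follows p (Suc m) = {\<omega> \<in> follows p m. X (Suc m) \<omega> = p (Suc m)}"
    by (auto simp: follows_def le_Suc_eq)
  also have "prob \<dots> = prob (follows p m) *
      (if p (Suc m) = p m + 1 then step_right_prob f \<Delta> p m else 1 - step_right_prob f \<Delta> p m)"
  proof (cases "p (Suc m) = p m + 1")
    case True
    then show ?thesis using prob_follows_right[of p m] by simp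
  next
    case False
    with s have e: "p (Suc m) + 1 = p m" by simp
    then have "{\<omega> \<in> follows p m. X (Suc m) \<omega> = p (Suc m)}
        = {\<omega> \<in> follows p m. X (Suc m) \<omega> + 1 = p m}" by auto
    then show ?thesis using prob_follows_left[of p m] False by simp
  qed
  also have "\<dots> = urn_weight f \<Delta> n p (Suc m)"
    unfolding IH using Suc.prems initial_weight_pos \<Delta>_pos by (subst urn_weight_Suc) auto
  finally show ?case .
qed

lemma reach_first_step:
  assumes "p m \<le> n"
  shows "{\<omega> \<in> {\<omega> \<in> follows p m. \<exists>i\<in>{m..m + Suc k}. Suc n \<le> X i \<omega>}. X (Suc m) \<omega> = y}
    = {\<omega> \<in> follows (p(Suc m := y)) (Suc m). \<exists>i\<in>{Suc m..Suc m + k}. Suc n \<le> X i \<omega>}"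
proof -
  have F: "follows (p(Suc m := y)) (Suc m) = {\<omega> \<in> follows p m. X (Suc m) \<omega> = y}"
    by (auto simp: follows_def le_Suc_eq)
  have "{m..m + Suc k} = insert m {Suc m..Suc m + k}" by auto
  moreover have "\<not> Suc n \<le> X m \<omega>" if "\<omega> \<in> follows p m" for \<omega> using that assms by (auto simp: follows_def)
  ultimately show ?thesis unfolding F by auto
qed

text \<open>
  Induction on the remaining time \<open>k\<close>, conditioning on the next step. The step is absorbed into the path
  weight on the mixture side and into the history on the side of the reinforced walk, so only the
  probabilities of single paths have to agree.
\<close>

lemma emeasure_follows_reach_eq:
  assumes "nn_path p m" "\<And>i. i < m \<Longrightarrow> p i \<le> n"
  shows "emeasure M {\<omega> \<in> follows p m. \<exists>i\<in>{m..m + k}. Suc n \<le> X i \<omega>}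
    = (\<integral>\<^sup>+u. ennreal (path_weight u n p m * hit_prob u (Suc n) k (p m)) \<partial>env f \<Delta> n)"
  using assms
proof (induction k arbitrary: p m)
  case 0
  have F: "emeasure M (follows p m) = (\<integral>\<^sup>+u. ennreal (path_weight u n p m) \<partial>env f \<Delta> n)"
    using prob_follows_eq[OF 0] nn_integral_path_weight[OF initial_weight_pos \<Delta>_pos]
    by (simp add: emeasure_eq_measure)
  have "{\<omega> \<in> follows p m. \<exists>i\<in>{m..m + 0}. Suc n \<le> X i \<omega>} = (if Suc n \<le> p m then follows p m else {})"
    by (auto simp: follows_def)
  then show ?case using F by simp
next
  case (Suc k)
  show ?case
  proof (cases "Suc n \<le> p m")
    case True
    then have "{\<omega> \<in> follows p m. \<exists>i\<in>{m..m + Suc k}. Suc n \<le> X i \<omega>} = follows p m"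
      by (auto simp: follows_def intro!: bexI[of _ m])
    then show ?thesis using True prob_follows_eq[OF Suc.prems]
        nn_integral_path_weight[OF initial_weight_pos \<Delta>_pos]
      by (simp add: emeasure_eq_measure)
  next
    case False
    define x where "x = p m"
    have x: "x \<le> n" using False by (simp add: x_def)
    define q1 where "q1 = p(Suc m := x + 1)"
    define q2 where "q2 = p(Suc m := x - 1)"
    let ?ev = "\<lambda>p m k. {\<omega> \<in> follows p m. \<exists>i\<in>{m..m + k}. Suc n \<le> X i \<omega>}"
    let ?h = "hit_prob"
    have q: "q1 i = p i" "q2 i = p i" if "i \<le> m" for i using that by (auto simp: q1_def q2_def)
    have qS: "q1 (Suc m) = x + 1" "q2 (Suc m) = x - 1" by (simp_all add: q1_def q2_def)
    have nn1: "nn_path q1 (Suc m)"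
      unfolding q1_def x_def by (rule nn_path_extend[OF Suc.prems(1)]) simp
    have nn2: "nn_path q2 (Suc m)" if "x \<noteq> 0"
      unfolding q2_def x_def by (rule nn_path_extend[OF Suc.prems(1)]) (use that in \<open>simp add: x_def\<close>)
    have le: "q1 i \<le> n" "q2 i \<le> n" if "i < Suc m" for i
      using that x Suc.prems(2)[of i] q[of i] by (cases "i = m"; simp add: x_def)+
    have w: "path_weight u n q1 m = path_weight u n p m" "path_weight u n q2 m = path_weight u n p m" for u
      using q by (auto intro!: path_weight_cong)
    have s1: "path_weight u n q1 (Suc m) = path_weight u n p m * right_prob u x" for u
      using path_weight_right[of q1 m n u] q[of m] x w(1)[of u] by (simp add: q1_def x_def)
    have s2: "path_weight u n q2 (Suc m) = path_weight u n p m * (1 - right_prob u x)" if "x \<noteq> 0" for u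
      using path_weight_left[of q2 m n u] q[of m] x w(2)[of u] that by (simp add: q2_def x_def)
    have ev1: "{\<omega> \<in> ?ev p m (Suc k). X (Suc m) \<omega> = x + 1} = ?ev q1 (Suc m) k"
      unfolding q1_def using False by (intro reach_first_step) simp
    have ev2: "{\<omega> \<in> ?ev p m (Suc k). X (Suc m) \<omega> + 1 = x} = ?ev q2 (Suc m) k" if "x \<noteq> 0"
    proof -
      have "{\<omega> \<in> ?ev p m (Suc k). X (Suc m) \<omega> + 1 = x} = {\<omega> \<in> ?ev p m (Suc k). X (Suc m) \<omega> = x - 1}"
        using that by auto
      also have "\<dots> = ?ev q2 (Suc m) k"
        unfolding q2_def using False by (intro reach_first_step) simp
      finally show ?thesis .
    qed
    have evm: "?ev p m k' \<in> sets M" "{\<omega> \<in> ?ev p m k'. X (Suc m) \<omega> = x + 1} \<in> sets M"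
      "{\<omega> \<in> ?ev p m k'. X (Suc m) \<omega> + 1 = x} \<in> sets M" for k'
      by measurable
    have [measurable]: "(\<lambda>u. path_weight u n p m) \<in> borel_measurable (env f \<Delta> n)" for p m
      by (rule measurable_path_weight)
    have [measurable]: "(\<lambda>u. ?h u (Suc n) k y) \<in> borel_measurable (env f \<Delta> n)" for y
      by (rule measurable_hit_prob)
    have I1: "emeasure M {\<omega> \<in> ?ev p m (Suc k). X (Suc m) \<omega> = x + 1}
        = (\<integral>\<^sup>+u. ennreal (path_weight u n q1 (Suc m) * ?h u (Suc n) k (x + 1)) \<partial>env f \<Delta> n)"
      unfolding ev1 using Suc.IH[OF nn1 le(1)] qS by simp
    define w2 where "w2 u = (if x = 0 then 0 else path_weight u n q2 (Suc m) * ?h u (Suc n) k (x - 1))" for u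
    have w2m [measurable]: "w2 \<in> borel_measurable (env f \<Delta> n)"
      unfolding w2_def by (cases "x = 0") auto
    have I2: "emeasure M {\<omega> \<in> ?ev p m (Suc k). X (Suc m) \<omega> + 1 = x}
        = (\<integral>\<^sup>+u. ennreal (w2 u) \<partial>env f \<Delta> n)"
    proof (cases "x = 0")
      case True
      then show ?thesis by (simp add: w2_def)
    next
      case x0: False
      then show ?thesis
        unfolding ev2[OF x0] w2_def using Suc.IH[OF nn2[OF x0] le(2)] qS by simp
    qed
    have "emeasure M (?ev p m (Suc k)) = emeasure M ({\<omega> \<in> ?ev p m (Suc k). X (Suc m) \<omega> = x + 1}
        \<union> {\<omega> \<in> ?ev p m (Suc k). X (Suc m) \<omega> + 1 = x})"
    proof (rule emeasure_eq_AE)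
      show "AE \<omega> in M. \<omega> \<in> ?ev p m (Suc k) \<longleftrightarrow>
          \<omega> \<in> {\<omega> \<in> ?ev p m (Suc k). X (Suc m) \<omega> = x + 1} \<union> {\<omega> \<in> ?ev p m (Suc k). X (Suc m) \<omega> + 1 = x}"
        using AE_follows_step[of p m] by eventually_elim (auto simp: x_def)
    qed (rule evm(1) sets.Un[OF evm(2,3)])+
    also have "\<dots> = emeasure M {\<omega> \<in> ?ev p m (Suc k). X (Suc m) \<omega> = x + 1}
        + emeasure M {\<omega> \<in> ?ev p m (Suc k). X (Suc m) \<omega> + 1 = x}"
      by (rule plus_emeasure[symmetric, OF evm(2,3)]) auto
    also have "\<dots> = (\<integral>\<^sup>+u. ennreal (path_weight u n q1 (Suc m) * ?h u (Suc n) k (x + 1)) + ennreal (w2 u)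
        \<partial>env f \<Delta> n)"
      unfolding I1 I2 by (rule nn_integral_add[symmetric]; measurable)
    also have "\<dots> = (\<integral>\<^sup>+u. ennreal (path_weight u n p m * ?h u (Suc n) (Suc k) (p m)) \<partial>env f \<Delta> n)"
    proof (rule nn_integral_cong_AE)
      show "AE u in env f \<Delta> n. ennreal (path_weight u n q1 (Suc m) * ?h u (Suc n) k (x + 1)) + ennreal (w2 u)
          = ennreal (path_weight u n p m * ?h u (Suc n) (Suc k) (p m))"
        using AE_env[OF initial_weight_pos \<Delta>_pos]
      proof eventually_elim
        case (elim u)
        then have u: "0 < u j \<and> u j < 1" if "1 \<le> j" "j < Suc n" for j using that by auto
        have h: "0 \<le> ?h u (Suc n) k y" for y using hit_prob_bounds[of "Suc n" u, OF u] by auto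
        have pw: "0 \<le> path_weight u n p m" for p m
          unfolding path_weight_def using elim
          by (intro prod_nonneg mult_nonneg_nonneg zero_le_power) (auto simp: less_imp_le)
        have w20: "0 \<le> w2 u" using h pw by (simp add: w2_def)
        have "path_weight u n q1 (Suc m) * ?h u (Suc n) k (x + 1) + w2 u
            = path_weight u n p m * ?h u (Suc n) (Suc k) (p m)"
        proof -
          have hS: "?h u (Suc n) (Suc k) (p m) = right_prob u x * ?h u (Suc n) k (x + 1)
              + (1 - right_prob u x) * ?h u (Suc n) k (x - 1)"
            using False by (simp add: x_def)
          show ?thesis
          proof (cases "x = 0")
            case True
            then show ?thesis unfolding hS s1 by (simp add: w2_def right_prob_def)
          next
            case False
            then show ?thesis unfolding hS s1 w2_def s2[OF False] by (simp add: algebra_simps)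
          qed
        qed
        then show ?case using h pw w20 by (simp flip: ennreal_plus)
      qed
    qed
    finally show ?thesis .
  qed
qed

lemma emeasure_reach_eq:
  "emeasure M {\<omega> \<in> space M. \<exists>i\<le>k. Suc n \<le> X i \<omega>}
    = (\<integral>\<^sup>+u. ennreal (hit_prob u (Suc n) k 0) \<partial>env f \<Delta> n)"
proof -
  have start': "AE \<omega> in M. X 0 \<omega> = 0" using start by (subst (asm) prob_eq_1) auto
  have "emeasure M {\<omega> \<in> space M. \<exists>i\<le>k. Suc n \<le> X i \<omega>}
      = emeasure M {\<omega> \<in> follows (\<lambda>_. 0) 0. \<exists>i\<in>{0..0 + k}. Suc n \<le> X i \<omega>}"
  proof (rule emeasure_eq_AE)
    show "AE \<omega> in M. \<omega> \<in> {\<omega> \<in> space M. \<exists>i\<le>k. Suc n \<le> X i \<omega>} \<longleftrightarrow>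
        \<omega> \<in> {\<omega> \<in> follows (\<lambda>_. 0) 0. \<exists>i\<in>{0..0 + k}. Suc n \<le> X i \<omega>}"
      using start' AE_space by eventually_elim (auto simp: follows_def)
  qed measurable
  also have "\<dots> = (\<integral>\<^sup>+u. ennreal (path_weight u n (\<lambda>_. 0) 0 * hit_prob u (Suc n) k 0) \<partial>env f \<Delta> n)"
    by (rule emeasure_follows_reach_eq) (auto simp: nn_path_def)
  finally show ?thesis by (simp add: path_weight_def)
qed

end

end


section \<open>The random environment of the linear weights\<close>

definition lin_weight :: "nat \<Rightarrow> real" where
  "lin_weight x = (if x = 0 then 1 else real x)"

abbreviation vertex_law :: "real \<Rightarrow> nat \<Rightarrow> real measure" where
  "vertex_law \<Delta> j \<equiv> beta_law (lin_weight j / (2 * \<Delta>)) ((lin_weight (j - 1) + \<Delta>) / (2 * \<Delta>))"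

lemma lin_weight_pos: "lin_weight x > 0"
  by (simp add: lin_weight_def)

text \<open>
  Moments of the odds of every order up to this bound are finite at all vertices, with room to spare.
\<close>

definition small_exponent :: "real \<Rightarrow> real" where
  "small_exponent \<Delta> = min (1 / (4 * \<Delta>)) (1 / 4)"

text \<open>
  At \<open>j\<close> the first Beta parameter is \<open>j / 2\<Delta>\<close> and, for \<open>j > 1\<close>, the second one exceeds it
  by \<open>(\<Delta> - 1) / 2\<Delta>\<close>. So, at the arguments shifted by \<open>s\<close>, the difference of digamma values is
  \<open>(\<Delta> - 1 + 4\<Delta>s) / j\<close> up to a multiple of \<open>1 / j^2\<close>.
\<close>

lemma odds_moment_le:
  assumes \<Delta>: "\<Delta> > 0"
  shows "\<exists>C\<ge>0. \<forall>s j. \<bar>s\<bar> \<le> small_exponent \<Delta> \<longrightarrow> 1 \<le> j \<longrightarrow>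
    (\<integral>\<^sup>+t. ennreal (odds t powr s) \<partial>vertex_law \<Delta> j)
      \<le> ennreal (exp (s * (\<Delta> - 1 + 4 * \<Delta> * s) / j + \<bar>s\<bar> * C / j\<^sup>2))"
proof -
  define \<theta> where "\<theta> = 1 / (2 * \<Delta>)"
  have \<theta>: "\<theta> > 0" using \<Delta> by (simp add: \<theta>_def)
  define c where "c = min (\<theta> / 2) (1 / 4)"
  have c: "0 < c" "c \<le> 1 / 4" "c \<le> \<theta> / 2" "c = small_exponent \<Delta>"
    using \<theta> by (auto simp: c_def small_exponent_def \<theta>_def)
  define K where "K = \<theta> + 1"
  define C where "C = 2 * K * (1 + K) / c\<^sup>2 + 1"
  have C: "C \<ge> 0" using \<theta> by (simp add: C_def K_def)
  have main: "(\<integral>\<^sup>+t. ennreal (odds t powr s) \<partial>vertex_law \<Delta> j)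
      \<le> ennreal (exp (s * (\<Delta> - 1 + 4 * \<Delta> * s) / j + \<bar>s\<bar> * C / j\<^sup>2))"
    if s: "\<bar>s\<bar> \<le> c" and j: "1 \<le> j" for s :: real and j :: nat
  proof -
    define a where "a = lin_weight j / (2 * \<Delta>)"
    define b where "b = (lin_weight (j - 1) + \<Delta>) / (2 * \<Delta>)"
    have a: "a = \<theta> * j" using j by (simp add: a_def lin_weight_def \<theta>_def)
    have b: "b = (if j = 1 then \<theta> + 1 / 2 else \<theta> * (real j - 1) + 1 / 2)"
      using j \<Delta> by (auto simp: b_def lin_weight_def \<theta>_def field_simps of_nat_diff)
    have j1: "1 \<le> real j" using j by simp
    have bge: "b \<ge> \<theta> * (real j - 1) + 1 / 2" using \<theta> by (simp add: b)
    have ble: "\<bar>b - \<theta> * j\<bar> \<le> \<theta> + 1 / 2" using \<theta> by (auto simp: b algebra_simps abs_le_iff)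
    have cj: "c * j \<le> \<theta> / 2 * j" "c * (real j - 1) \<le> \<theta> * (real j - 1)"
      using c j1 \<theta> by (auto intro!: mult_right_mono)
    have tj: "\<theta> / 2 \<le> \<theta> / 2 * j" using j1 \<theta> by simp
    have ca: "c * j \<le> a - s" using cj(1) tj s c unfolding a by linarith
    have cb: "c * j \<le> b + s" using cj(2) bge s c by (simp add: algebra_simps)
    have cj0: "0 < c * j" using c j by simp
    have "\<bar>Digamma (b + s) - Digamma (a - s) - ((b + s) - (a - s)) / (\<theta> * j)\<bar>
        \<le> 2 * K * (1 + K) / c\<^sup>2 / (real j)\<^sup>2"
    proof (rule Digamma_diff_approx)
      show "c * j \<le> \<theta> * j" using cj(1) tj \<theta> j1 c by (intro mult_right_mono) auto
      show "\<bar>a - s - \<theta> * j\<bar> \<le> K" using s c \<theta> by (simp add: a K_def)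
      show "\<bar>b + s - \<theta> * j\<bar> \<le> K" using s c ble by (simp add: K_def)
    qed (use c j1 ca cb in auto)
    \<comment> \<open>The vertex 1 is special because the edge to its left has weight 1 instead of 0; the extra 1 is covered by \<open>1 / j^2\<close>.\<close>
    moreover have "\<bar>((b + s) - (a - s)) / (\<theta> * j) - (\<Delta> - 1 + 4 * \<Delta> * s) / j\<bar> \<le> 1 / (real j)\<^sup>2"
    proof (cases "j = 1")
      case True
      have "((b + s) - (a - s)) / (\<theta> * j) = \<Delta> + 4 * \<Delta> * s"
        using True \<Delta> by (simp add: a b) (simp add: \<theta>_def field_simps)
      then show ?thesis using True by simp
    next
      case False
      have "((b + s) - (a - s)) / (\<theta> * j) = ((1 / 2 - \<theta> + 2 * s) / \<theta>) / j"
        using False by (simp add: a b algebra_simps)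
      also have "(1 / 2 - \<theta> + 2 * s) / \<theta> = \<Delta> - 1 + 4 * \<Delta> * s"
        using \<Delta> by (simp add: \<theta>_def field_simps)
      finally show ?thesis by simp
    qed
    ultimately have d: "\<bar>Digamma (b + s) - Digamma (a - s) - (\<Delta> - 1 + 4 * \<Delta> * s) / j\<bar> \<le> C / (real j)\<^sup>2"
      unfolding C_def add_divide_distrib by linarith
    have "s * (Digamma (b + s) - Digamma (a - s)) - s * (\<Delta> - 1 + 4 * \<Delta> * s) / j
        = s * (Digamma (b + s) - Digamma (a - s) - (\<Delta> - 1 + 4 * \<Delta> * s) / j)"
      by (simp add: algebra_simps)
    also have "\<dots> \<le> \<bar>s\<bar> * \<bar>Digamma (b + s) - Digamma (a - s) - (\<Delta> - 1 + 4 * \<Delta> * s) / j\<bar>"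
      by (metis abs_ge_self abs_mult)
    also have "\<dots> \<le> \<bar>s\<bar> * (C / (real j)\<^sup>2)" by (intro mult_left_mono d) auto
    finally have e: "s * (Digamma (b + s) - Digamma (a - s))
        \<le> s * (\<Delta> - 1 + 4 * \<Delta> * s) / j + \<bar>s\<bar> * C / (real j)\<^sup>2" by simp
    have "a > 0" "b > 0" using lin_weight_pos[of j] lin_weight_pos[of "j - 1"] \<Delta> by (auto simp: a_def b_def)
    then have "(\<integral>\<^sup>+t. ennreal (odds t powr s) \<partial>beta_law a b)
        \<le> ennreal (exp (s * (Digamma (b + s) - Digamma (a - s))))"
      unfolding odds_def using ca cb cj0 by (intro nn_integral_odds_powr_beta_law_le) auto
    also have "\<dots> \<le> ennreal (exp (s * (\<Delta> - 1 + 4 * \<Delta> * s) / j + \<bar>s\<bar> * C / (real j)\<^sup>2))"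
      using e by (intro ennreal_leI) simp
    finally show ?thesis by (simp add: a_def b_def)
  qed
  show ?thesis using C main unfolding c(4) by blast
qed

lemma sum_inverse_squares_le_2: "(\<Sum>j\<in>{1..x}. 1 / (real j)\<^sup>2) \<le> 2"
proof -
  have "(\<Sum>j\<in>{1..Suc x}. 1 / (real j)\<^sup>2) \<le> 2 - 1 / real (Suc x)" for x
  proof (induction x)
    case (Suc x)
    have "1 / (real (Suc (Suc x)))\<^sup>2 \<le> 1 / (real (Suc x) * real (Suc (Suc x)))"
      unfolding power2_eq_square by (intro divide_left_mono mult_right_mono) auto
    also have "\<dots> = 1 / real (Suc x) - 1 / real (Suc (Suc x))" by (simp add: field_simps)
    finally show ?case using Suc by simp
  qed simp
  from this[of "x - 1"] show ?thesis by (cases x) (simp_all, smt (verit) of_nat_0_le_iff divide_nonneg_nonneg)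
qed

lemma harm_minus_ln_bounds:
  "ln (real x + 1) \<le> harm x" "harm x \<le> ln (real x + 1) + 1"
proof -
  show "ln (real x + 1) \<le> harm x" by (rule ln_le_harm)
  show "harm x \<le> ln (real x + 1) + 1"
  proof (cases x)
    case (Suc n)
    have "harm (Suc n) - ln (real (Suc n)) \<le> 1"
      using decseqD[OF decseq_harm_diff_ln, of 0 n] by (simp add: harm_expand)
    moreover have "ln (real (Suc n)) \<le> ln (real (Suc n) + 1)" by simp
    ultimately show ?thesis unfolding Suc by linarith
  qed (simp add: harm_expand)
qed

text \<open>
  The factors \<open>odds (u j) powr s\<close>, divided by upper bounds of their means, satisfy the maximal inequality.
  The product of these bounds is \<open>x powr (s (\<Delta> - 1) + 4\<Delta>s^2)\<close> up to a constant, and the quadratic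
  term is absorbed into the power of the number of vertices.
\<close>

lemma odds_prod_powr_tail:
  assumes \<Delta>: "\<Delta> > 0" and s: "\<bar>s\<bar> \<le> small_exponent \<Delta>"
  shows "\<exists>K\<ge>0. \<forall>n. emeasure (env lin_weight \<Delta> n) {u \<in> space (env lin_weight \<Delta> n).
      \<exists>x\<le>n. real (Suc n) powr h * real (x + 1) powr (s * (\<Delta> - 1)) \<le> odds_prod u x powr s}
    \<le> ennreal (K * real (Suc n) powr - (h - 4 * \<Delta> * s\<^sup>2))"
proof -
  obtain C where C: "C \<ge> 0" and mom: "\<And>j. 1 \<le> j \<Longrightarrow>
    (\<integral>\<^sup>+t. ennreal (odds t powr s) \<partial>vertex_law \<Delta> j)
      \<le> ennreal (exp (s * (\<Delta> - 1 + 4 * \<Delta> * s) / j + \<bar>s\<bar> * C / j\<^sup>2))"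
    using odds_moment_le[OF \<Delta>] s by blast
  define q where "q = s * (\<Delta> - 1 + 4 * \<Delta> * s)"
  have q: "q = s * (\<Delta> - 1) + 4 * \<Delta> * s\<^sup>2" by (simp add: q_def power2_eq_square algebra_simps)
  define E where "E j = q / real j + \<bar>s\<bar> * C / (real j)\<^sup>2" for j :: nat
  \<comment> \<open>\<open>D\<close> collects the error of replacing the harmonic number by the logarithm, which is at most 1, and the sum of the quadratic terms.\<close>
  define D where "D = \<bar>q\<bar> + \<bar>s\<bar> * C * 2"
  have sumE: "(\<Sum>j\<in>{1..x}. E j) \<le> q * ln (real (x + 1)) + D" for x
  proof -
    have "(\<Sum>j\<in>{1..x}. E j) = q * harm x + \<bar>s\<bar> * C * (\<Sum>j\<in>{1..x}. 1 / (real j)\<^sup>2)"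
      by (simp add: E_def sum.distrib sum_distrib_left harm_def divide_inverse)
    also have "q * harm x \<le> q * ln (real (x + 1)) + \<bar>q\<bar>"
    proof -
      have "q * (harm x - ln (real (x + 1))) \<le> \<bar>q\<bar> * \<bar>harm x - ln (real (x + 1))\<bar>"
        by (metis abs_ge_self abs_mult)
      also have "\<dots> \<le> \<bar>q\<bar> * 1"
        using harm_minus_ln_bounds[of x] by (intro mult_left_mono) (auto simp: add_ac)
      finally show ?thesis by (simp add: algebra_simps)
    qed
    also have "\<bar>s\<bar> * C * (\<Sum>j\<in>{1..x}. 1 / (real j)\<^sup>2) \<le> \<bar>s\<bar> * C * 2"
      using C by (intro mult_left_mono sum_inverse_squares_le_2) auto
    finally show ?thesis by (simp add: D_def)
  qed
  define Z where "Z j t = odds t powr s * exp (- E j)" for j :: nat and t :: real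
  have Zm: "Z j \<in> borel_measurable borel" for j unfolding Z_def odds_def by measurable
  have Z0: "0 \<le> Z j t" for j t by (simp add: Z_def)
  have Z1: "(\<integral>\<^sup>+t. ennreal (Z j t) \<partial>vertex_law \<Delta> j) \<le> 1" if "1 \<le> j" for j
  proof -
    have "(\<integral>\<^sup>+t. ennreal (Z j t) \<partial>vertex_law \<Delta> j)
        = (\<integral>\<^sup>+t. ennreal (odds t powr s) \<partial>vertex_law \<Delta> j) * ennreal (exp (- E j))"
      by (subst nn_integral_multc[symmetric]) (auto simp: Z_def ennreal_mult odds_def)
    also have "\<dots> \<le> ennreal (exp (E j)) * ennreal (exp (- E j))"
      using mom[OF that] by (intro mult_right_mono) (auto simp: E_def q_def)
    also have "\<dots> = 1" by (simp add: ennreal_mult[symmetric] exp_minus)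
    finally show ?thesis .
  qed
  have "emeasure (env lin_weight \<Delta> n) {u \<in> space (env lin_weight \<Delta> n).
      \<exists>x\<le>n. real (Suc n) powr h * real (x + 1) powr (s * (\<Delta> - 1)) \<le> odds_prod u x powr s}
    \<le> ennreal (exp D * real (Suc n) powr - (h - 4 * \<Delta> * s\<^sup>2))" for n
  proof -
    define N where "N = real (Suc n)"
    have N: "N \<ge> 1" by (simp add: N_def)
    \<comment> \<open>The largest threshold for the normalized product that every \<open>x \<le> n\<close> in the event exceeds.\<close>
    define l where "l = exp (- D) * N powr (h - 4 * \<Delta> * s\<^sup>2)"
    have l: "l > 0" using N by (simp add: l_def)
    let ?P = "env lin_weight \<Delta> n"
    have comp: "(\<lambda>u. u j) \<in> borel_measurable ?P" if "j \<in> {1..x}" "x \<le> n" for x j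
      using that by (intro measurable_env_component) auto
    have Zp: "(\<lambda>u. \<Prod>j\<in>{1..x}. Z j (u j)) \<in> borel_measurable ?P" if "x \<le> n" for x
      using that by (intro borel_measurable_prod measurable_compose[OF comp Zm])
    have "emeasure ?P {u \<in> space ?P.
        \<exists>x\<le>n. N powr h * real (x + 1) powr (s * (\<Delta> - 1)) \<le> odds_prod u x powr s}
      \<le> emeasure ?P {u \<in> space ?P. \<exists>x\<le>n. l \<le> (\<Prod>j\<in>{1..x}. Z j (u j))}"
    proof (rule emeasure_mono_AE)
      show "AE u in ?P. u \<in> {u \<in> space ?P.
          \<exists>x\<le>n. N powr h * real (x + 1) powr (s * (\<Delta> - 1)) \<le> odds_prod u x powr s} \<longrightarrow>
        u \<in> {u \<in> space ?P. \<exists>x\<le>n. l \<le> (\<Prod>j\<in>{1..x}. Z j (u j))}"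
        using AE_env[OF lin_weight_pos \<Delta>]
      proof eventually_elim
        case (elim u)
        have "l \<le> (\<Prod>j\<in>{1..x}. Z j (u j))"
          if x: "x \<le> n" and le: "N powr h * real (x + 1) powr (s * (\<Delta> - 1)) \<le> odds_prod u x powr s" for x
        proof -
          have "l = N powr h * exp (- D) * N powr - (4 * \<Delta> * s\<^sup>2)"
            by (simp add: l_def powr_diff powr_minus field_simps)
          also have "\<dots> \<le> N powr h * exp (- D) * real (x + 1) powr - (4 * \<Delta> * s\<^sup>2)"
            using x \<Delta> by (intro mult_left_mono powr_mono2') (auto simp: N_def)
          also have "\<dots> = N powr h * real (x + 1) powr (s * (\<Delta> - 1)) *
              (exp (- D) * real (x + 1) powr - q)"
            by (simp add: q powr_add[symmetric] powr_minus field_simps)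
          also have "\<dots> \<le> odds_prod u x powr s * exp (- (\<Sum>j\<in>{1..x}. E j))"
          proof (intro mult_mono le)
            have "exp (- D) * real (x + 1) powr - q = exp (- (q * ln (real (x + 1)) + D))"
              by (simp add: powr_def exp_add[symmetric])
            also have "\<dots> \<le> exp (- (\<Sum>j\<in>{1..x}. E j))" using sumE[of x] by simp
            finally show "exp (- D) * real (x + 1) powr - q \<le> exp (- (\<Sum>j\<in>{1..x}. E j))" .
          qed auto
          also have "odds_prod u x powr s = (\<Prod>j\<in>{1..x}. odds (u j) powr s)"
            unfolding odds_prod_def using elim x
            by (subst prod_powr_distrib) (auto simp: odds_def less_imp_le)
          also have "\<dots> * exp (- (\<Sum>j\<in>{1..x}. E j)) = (\<Prod>j\<in>{1..x}. Z j (u j))"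
            by (simp add: Z_def prod.distrib exp_sum[symmetric] sum_negf)
          finally show ?thesis .
        qed
        then show ?case by blast
      qed
      show "{u \<in> space ?P. \<exists>x\<le>n. l \<le> (\<Prod>j\<in>{1..x}. Z j (u j))} \<in> sets ?P"
      proof -
        have "{u \<in> space ?P. \<exists>x\<le>n. l \<le> (\<Prod>j\<in>{1..x}. Z j (u j))}
            = (\<Union>x\<in>{..n}. {u \<in> space ?P. l \<le> (\<Prod>j\<in>{1..x}. Z j (u j))})" by auto
        also have "\<dots> \<in> sets ?P"
          using Zp by (intro sets.finite_UN borel_measurable_le borel_measurable_const) auto
        finally show ?thesis .
      qed
    qed
    also have "\<dots> \<le> ennreal (1 / l)"
      unfolding env_def
      by (rule prod_maximal_inequality[where B = "vertex_law \<Delta>", OF prob_space_env_factor[OF lin_weight_pos \<Delta>] sets_beta_law Zm Z0 Z1 l])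
    also have "1 / l = exp D * N powr - (h - 4 * \<Delta> * s\<^sup>2)"
      by (simp only: l_def exp_minus powr_minus divide_inverse inverse_mult_distrib inverse_inverse_eq mult_1)
    finally show ?thesis by (simp add: N_def)
  qed
  then show ?thesis by (intro exI[of _ "exp D"]) auto
qed

definition regular_env :: "real \<Rightarrow> real \<Rightarrow> nat \<Rightarrow> (nat \<Rightarrow> real) \<Rightarrow> bool" where
  "regular_env \<Delta> \<eta> n u \<longleftrightarrow> (\<forall>x\<le>n.
     real (Suc n) powr - \<eta> * real (x + 1) powr (\<Delta> - 1) \<le> odds_prod u x \<and>
     odds_prod u x \<le> real (Suc n) powr \<eta> * real (x + 1) powr (\<Delta> - 1))"

lemma measurable_odds_prod:
  "x \<le> n \<Longrightarrow> (\<lambda>u. odds_prod u x) \<in> borel_measurable (env f \<Delta> n)"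
  unfolding odds_prod_def odds_def
  by (intro borel_measurable_prod borel_measurable_divide borel_measurable_diff
      borel_measurable_const measurable_env_component) auto

lemma irregular_env_measurable:
  "{u \<in> space (env f \<Delta>' n). \<not> regular_env \<Delta> \<eta> n u} \<in> sets (env f \<Delta>' n)"
proof -
  let ?P = "env f \<Delta>' n"
  have "{u \<in> space ?P. \<not> regular_env \<Delta> \<eta> n u} = (\<Union>x\<in>{..n}.
      {u \<in> space ?P. odds_prod u x < real (Suc n) powr - \<eta> * real (x + 1) powr (\<Delta> - 1)} \<union>
      {u \<in> space ?P. real (Suc n) powr \<eta> * real (x + 1) powr (\<Delta> - 1) < odds_prod u x})"
    by (auto simp: regular_env_def not_le)
  also have "\<dots> \<in> sets ?P"
    by (intro sets.finite_UN sets.Un borel_measurable_less borel_measurable_const measurable_odds_prod) auto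
  finally show ?thesis .
qed

text \<open>
  The tail bound with exponents \<open>s\<close> and \<open>- s\<close>. It decays because the gain \<open>s \<eta>\<close> is linear in \<open>s\<close> while the
  loss \<open>4\<Delta>s^2\<close> is quadratic.
\<close>

lemma irregular_env_prob:
  assumes \<Delta>: "\<Delta> > 0" and \<eta>: "\<eta> > 0"
  shows "\<exists>K\<ge>0. \<exists>\<delta>>0. \<forall>n. emeasure (env lin_weight \<Delta> n)
      {u \<in> space (env lin_weight \<Delta> n). \<not> regular_env \<Delta> \<eta> n u}
    \<le> ennreal (K * real (Suc n) powr - \<delta>)"
proof -
  \<comment> \<open>The second bound on \<open>s\<close> makes the loss at most half of the gain.\<close>
  define s where "s = min (small_exponent \<Delta>) (\<eta> / (8 * \<Delta>))"
  have s: "0 < s" "s \<le> small_exponent \<Delta>" "s \<le> \<eta> / (8 * \<Delta>)"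
    using \<Delta> \<eta> by (auto simp: s_def small_exponent_def)
  define \<delta> where "\<delta> = s * \<eta> - 4 * \<Delta> * s\<^sup>2"
  have "4 * \<Delta> * s * s \<le> 4 * \<Delta> * (\<eta> / (8 * \<Delta>)) * s"
    using s \<Delta> by (intro mult_right_mono mult_left_mono) auto
  also have "\<dots> = s * \<eta> / 2" using \<Delta> by simp
  finally have \<delta>: "\<delta> > 0" using mult_pos_pos[OF s(1) \<eta>] by (simp add: \<delta>_def power2_eq_square)
  obtain K1 where K1: "K1 \<ge> 0" and up: "\<And>n. emeasure (env lin_weight \<Delta> n) {u \<in> space (env lin_weight \<Delta> n).
      \<exists>x\<le>n. real (Suc n) powr (s * \<eta>) * real (x + 1) powr (s * (\<Delta> - 1)) \<le> odds_prod u x powr s}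
    \<le> ennreal (K1 * real (Suc n) powr - \<delta>)"
    using odds_prod_powr_tail[OF \<Delta>, of s "s * \<eta>"] s unfolding \<delta>_def by auto
  obtain K2 where K2: "K2 \<ge> 0" and lo: "\<And>n. emeasure (env lin_weight \<Delta> n) {u \<in> space (env lin_weight \<Delta> n).
      \<exists>x\<le>n. real (Suc n) powr (s * \<eta>) * real (x + 1) powr (- s * (\<Delta> - 1)) \<le> odds_prod u x powr - s}
    \<le> ennreal (K2 * real (Suc n) powr - \<delta>)"
    using odds_prod_powr_tail[OF \<Delta>, of "- s" "s * \<eta>"] s unfolding \<delta>_def by auto
  have "emeasure (env lin_weight \<Delta> n) {u \<in> space (env lin_weight \<Delta> n). \<not> regular_env \<Delta> \<eta> n u}
      \<le> ennreal ((K1 + K2) * real (Suc n) powr - \<delta>)" for n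
  proof -
    let ?P = "env lin_weight \<Delta> n" and ?N = "real (Suc n)"
    let ?U = "{u \<in> space ?P. \<exists>x\<le>n. ?N powr (s * \<eta>) * real (x + 1) powr (s * (\<Delta> - 1)) \<le> odds_prod u x powr s}"
    let ?L = "{u \<in> space ?P. \<exists>x\<le>n. ?N powr (s * \<eta>) * real (x + 1) powr (- s * (\<Delta> - 1)) \<le> odds_prod u x powr - s}"
    have m: "{u \<in> space ?P. \<exists>x\<le>n. a x \<le> odds_prod u x powr t} \<in> sets ?P" for a t
    proof -
      have "{u \<in> space ?P. \<exists>x\<le>n. a x \<le> odds_prod u x powr t}
          = (\<Union>x\<in>{..n}. {u \<in> space ?P. a x \<le> odds_prod u x powr t})" by auto
      also have "\<dots> \<in> sets ?P"
        by (intro sets.finite_UN borel_measurable_le borel_measurable_const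
            powr_real_measurable measurable_odds_prod) auto
      finally show ?thesis .
    qed
    have "emeasure ?P {u \<in> space ?P. \<not> regular_env \<Delta> \<eta> n u} \<le> emeasure ?P (?U \<union> ?L)"
    proof (rule emeasure_mono_AE)
      show "AE u in ?P. u \<in> {u \<in> space ?P. \<not> regular_env \<Delta> \<eta> n u} \<longrightarrow> u \<in> ?U \<union> ?L"
        using AE_env[OF lin_weight_pos \<Delta>]
      proof (eventually_elim, intro impI)
        fix u assume u: "\<forall>x\<in>{1..n}. 0 < u x \<and> u x < 1"
          and bad: "u \<in> {u \<in> space ?P. \<not> regular_env \<Delta> \<eta> n u}"
        then obtain x where x: "x \<le> n" and c: "odds_prod u x < ?N powr - \<eta> * real (x + 1) powr (\<Delta> - 1) \<or>
            ?N powr \<eta> * real (x + 1) powr (\<Delta> - 1) < odds_prod u x"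
          by (auto simp: regular_env_def not_le)
        have pos: "odds_prod u x > 0" using u x by (intro odds_prod_pos) auto
        from c show "u \<in> ?U \<union> ?L"
        proof
          assume "odds_prod u x < ?N powr - \<eta> * real (x + 1) powr (\<Delta> - 1)"
          then have "(?N powr - \<eta> * real (x + 1) powr (\<Delta> - 1)) powr - s \<le> odds_prod u x powr - s"
            using pos s by (intro powr_mono2') auto
          then have "?N powr (s * \<eta>) * real (x + 1) powr (- s * (\<Delta> - 1)) \<le> odds_prod u x powr - s"
            by (simp add: powr_mult powr_powr mult_ac)
          then show ?thesis using x bad by blast
        next
          assume "?N powr \<eta> * real (x + 1) powr (\<Delta> - 1) < odds_prod u x"
          then have "(?N powr \<eta> * real (x + 1) powr (\<Delta> - 1)) powr s \<le> odds_prod u x powr s"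
            using s by (intro powr_mono2) auto
          then have "?N powr (s * \<eta>) * real (x + 1) powr (s * (\<Delta> - 1)) \<le> odds_prod u x powr s"
            by (simp add: powr_mult powr_powr mult_ac)
          then show ?thesis using x bad by blast
        qed
      qed
    qed (intro sets.Un m)
    also have "\<dots> \<le> emeasure ?P ?U + emeasure ?P ?L"
      by (intro emeasure_subadditive m)
    also have "\<dots> \<le> ennreal (K1 * ?N powr - \<delta>) + ennreal (K2 * ?N powr - \<delta>)"
      by (intro add_mono up lo)
    also have "\<dots> = ennreal ((K1 + K2) * ?N powr - \<delta>)"
      using K1 K2 by (simp add: ennreal_plus[symmetric] distrib_right del: ennreal_plus)
    finally show ?thesis .
  qed
  then show ?thesis using K1 K2 \<delta> by (intro exI[of _ "K1 + K2"] conjI exI[of _ \<delta>]) auto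
qed

text \<open>
  A ratio \<open>r = (x + 1) / (y + 1)\<close> lies between \<open>1\<close> and \<open>N = n + 1\<close>. With \<open>\<gamma> = max 2 \<Delta>\<close> this gives
  \<open>r powr (\<Delta> - 1) \<le> N powr (\<gamma> - 2) * r\<close>, and summing \<open>r\<close> over \<open>y\<close> costs only a logarithm.
\<close>

lemma sum_ratio_powr_upper:
  assumes \<eta>: "\<eta> > 0"
  shows "(\<Sum>x\<le>n. \<Sum>y\<le>x. (real (x + 1) / real (y + 1)) powr (\<Delta> - 1))
    \<le> (1 + 1 / \<eta>) * real (Suc n) powr (max 2 \<Delta> + \<eta>)"
proof -
  define N where "N = real (Suc n)"
  define \<gamma> where "\<gamma> = max 2 \<Delta>"
  have N: "N \<ge> 1" by (simp add: N_def)
  have \<gamma>: "\<gamma> \<ge> 2" "\<gamma> \<ge> \<Delta>" by (auto simp: \<gamma>_def)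
  have ratio: "(real (x + 1) / real (y + 1)) powr (\<Delta> - 1) \<le> N powr (\<gamma> - 1) * (1 / real (y + 1))"
    if "x \<le> n" "y \<le> x" for x y
  proof -
    have r: "1 \<le> real (x + 1) / real (y + 1)" using that by simp
    have "real (x + 1) \<le> N" using that by (simp add: N_def)
    then have le: "real (x + 1) / real (y + 1) \<le> N / real (y + 1)" by (rule divide_right_mono) simp
    also have "\<dots> \<le> N" using N by (simp add: field_simps)
    finally have le': "real (x + 1) / real (y + 1) \<le> N" .
    have "(real (x + 1) / real (y + 1)) powr (\<Delta> - 1) \<le> (real (x + 1) / real (y + 1)) powr (\<gamma> - 1)"
      using r \<gamma> by (intro powr_mono) auto
    also have "\<dots> = (real (x + 1) / real (y + 1)) powr (\<gamma> - 2) * (real (x + 1) / real (y + 1))"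
      using r powr_mult_base[of "real (x + 1) / real (y + 1)" "\<gamma> - 2"] by (simp add: mult_ac)
    also have "\<dots> \<le> N powr (\<gamma> - 2) * (N / real (y + 1))"
      using le le' r \<gamma> by (intro mult_mono powr_mono2) auto
    also have "\<dots> = N powr (\<gamma> - 1) * (1 / real (y + 1))"
      using N powr_mult_base[of N "\<gamma> - 2"] by (simp add: mult_ac)
    finally show ?thesis .
  qed
  have h: "(\<Sum>y\<le>x. 1 / real (y + 1)) \<le> (1 + 1 / \<eta>) * N powr \<eta>" if "x \<le> n" for x
  proof -
    have "(\<Sum>y\<le>x. 1 / real (y + 1)) = harm (Suc x)"
      unfolding harm_altdef by (simp add: lessThan_Suc_atMost inverse_eq_divide add_ac)
    also have "\<dots> \<le> harm (Suc n)" using that by (intro harm_mono) auto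
    also have "\<dots> \<le> ln N + 1"
      using decseqD[OF decseq_harm_diff_ln, of 0 n] by (simp add: N_def harm_expand)
    also have "\<dots> \<le> N powr \<eta> / \<eta> + N powr \<eta>"
      using ln_powr_bound[OF N \<eta>] ge_one_powr_ge_zero[of N \<eta>] N \<eta> by (intro add_mono) auto
    finally show ?thesis by (simp add: algebra_simps)
  qed
  have "(\<Sum>x\<le>n. \<Sum>y\<le>x. (real (x + 1) / real (y + 1)) powr (\<Delta> - 1))
      \<le> (\<Sum>x\<le>n. N powr (\<gamma> - 1) * ((1 + 1 / \<eta>) * N powr \<eta>))"
  proof (rule sum_mono)
    fix x assume x: "x \<in> {..n}"
    have "(\<Sum>y\<le>x. (real (x + 1) / real (y + 1)) powr (\<Delta> - 1))
        \<le> (\<Sum>y\<le>x. N powr (\<gamma> - 1) * (1 / real (y + 1)))"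
      using x by (intro sum_mono ratio) auto
    also have "\<dots> \<le> N powr (\<gamma> - 1) * ((1 + 1 / \<eta>) * N powr \<eta>)"
      unfolding sum_distrib_left[symmetric] using x by (intro mult_left_mono h) auto
    finally show "(\<Sum>y\<le>x. (real (x + 1) / real (y + 1)) powr (\<Delta> - 1))
      \<le> N powr (\<gamma> - 1) * ((1 + 1 / \<eta>) * N powr \<eta>)" .
  qed
  also have "\<dots> = (1 + 1 / \<eta>) * (N * N powr (\<gamma> - 1) * N powr \<eta>)"
    by (simp add: N_def)
  also have "N * N powr (\<gamma> - 1) * N powr \<eta> = N powr (\<gamma> + \<eta>)"
    using N powr_mult_base[of N "\<gamma> - 1"] by (simp add: powr_add)
  finally show ?thesis by (simp add: N_def \<gamma>_def)
qed

text \<open>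
  For \<open>\<Delta> \<le> 2\<close> each power is at least the inverse ratio \<open>(y + 1) / (x + 1)\<close>, and these sum to the order
  \<open>N^2\<close>. For \<open>\<Delta> > 2\<close> the terms with \<open>y = 0\<close> and \<open>x\<close> in the upper half of the range suffice.
\<close>

lemma sum_ratio_powr_lower:
  assumes \<Delta>: "\<Delta> > 0"
  shows "\<exists>c>0. \<forall>n. c * real (Suc n) powr max 2 \<Delta>
    \<le> (\<Sum>x\<le>n. \<Sum>y\<le>x. (real (x + 1) / real (y + 1)) powr (\<Delta> - 1))"
proof (cases "\<Delta> \<le> 2")
  case True
  have "(1 / 4) * real (Suc n) powr max 2 \<Delta>
    \<le> (\<Sum>x\<le>n. \<Sum>y\<le>x. (real (x + 1) / real (y + 1)) powr (\<Delta> - 1))" for n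
  proof -
    have gauss: "(\<Sum>y\<le>x. real (y + 1)) = real (x + 1) * real (x + 2) / 2" for x
      by (induction x) (auto simp: field_simps)
    have "(1 / 4) * real (Suc n) powr max 2 \<Delta> \<le> (\<Sum>x\<le>n. real (x + 1)) / 2"
      using True unfolding gauss by (simp add: powr_numeral power2_eq_square field_simps)
    also have "\<dots> = (\<Sum>x\<le>n. real (x + 1) / 2)" by (simp only: sum_divide_distrib)
    also have "\<dots> \<le> (\<Sum>x\<le>n. \<Sum>y\<le>x. (real (x + 1) / real (y + 1)) powr (\<Delta> - 1))"
    proof (rule sum_mono)
      fix x
      have "real (x + 1) / 2 \<le> (\<Sum>y\<le>x. real (y + 1)) / real (x + 1)"
        unfolding gauss by (simp add: field_simps)
      also have "\<dots> = (\<Sum>y\<le>x. real (y + 1) / real (x + 1))" by (simp only: sum_divide_distrib)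
      also have "\<dots> \<le> (\<Sum>y\<le>x. (real (x + 1) / real (y + 1)) powr (\<Delta> - 1))"
      proof (rule sum_mono)
        fix y assume "y \<in> {..x}"
        then have r: "1 \<le> real (x + 1) / real (y + 1)" by simp
        have "real (y + 1) / real (x + 1) = (real (x + 1) / real (y + 1)) powr - 1"
          using r by (simp add: powr_minus_divide)
        also have "\<dots> \<le> (real (x + 1) / real (y + 1)) powr (\<Delta> - 1)"
          using r \<Delta> by (intro powr_mono) auto
        finally show "real (y + 1) / real (x + 1) \<le> (real (x + 1) / real (y + 1)) powr (\<Delta> - 1)" .
      qed
      finally show "real (x + 1) / 2 \<le> (\<Sum>y\<le>x. (real (x + 1) / real (y + 1)) powr (\<Delta> - 1))" .
    qed
    finally show ?thesis .
  qed
  then show ?thesis by (intro exI[of _ "1 / 4"]) auto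
next
  case False
  have "(1 / 2) powr \<Delta> * real (Suc n) powr max 2 \<Delta>
    \<le> (\<Sum>x\<le>n. \<Sum>y\<le>x. (real (x + 1) / real (y + 1)) powr (\<Delta> - 1))" for n
  proof -
    define h where "h = real (Suc n) / 2"
    have h: "h > 0" by (simp add: h_def)
    have "(1 / 2) powr \<Delta> * real (Suc n) powr max 2 \<Delta> = h powr \<Delta>"
      using False by (simp add: h_def max_def powr_divide)
    also have "\<dots> = h * h powr (\<Delta> - 1)" using h powr_mult_base[of h "\<Delta> - 1"] by simp
    also have "\<dots> \<le> (\<Sum>x\<in>{Suc n div 2..n}. h powr (\<Delta> - 1))"
    proof -
      have "h \<le> real (card {Suc n div 2..n})" unfolding h_def by simp
      then show ?thesis by (simp add: mult_right_mono)
    qed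
    also have "\<dots> \<le> (\<Sum>x\<in>{Suc n div 2..n}. real (x + 1) powr (\<Delta> - 1))"
    proof (intro sum_mono powr_mono2)
      fix x assume "x \<in> {Suc n div 2..n}"
      then have "Suc n \<le> 2 * (x + 1)" by auto
      then have "real (Suc n) \<le> 2 * real (x + 1)" by (metis of_nat_le_iff of_nat_mult of_nat_numeral)
      then show "h \<le> real (x + 1)" by (simp add: h_def)
    qed (use h False in auto)
    also have "\<dots> \<le> (\<Sum>x\<le>n. real (x + 1) powr (\<Delta> - 1))"
      by (intro sum_mono2) auto
    also have "\<dots> \<le> (\<Sum>x\<le>n. \<Sum>y\<le>x. (real (x + 1) / real (y + 1)) powr (\<Delta> - 1))"
    proof (rule sum_mono)
      fix x
      have "(real (x + 1) / real (0 + 1)) powr (\<Delta> - 1) \<le> (\<Sum>y\<le>x. (real (x + 1) / real (y + 1)) powr (\<Delta> - 1))"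
        by (rule member_le_sum) auto
      then show "real (x + 1) powr (\<Delta> - 1) \<le> (\<Sum>y\<le>x. (real (x + 1) / real (y + 1)) powr (\<Delta> - 1))"
        by simp
    qed
    finally show ?thesis .
  qed
  then show ?thesis by (intro exI[of _ "(1 / 2) powr \<Delta>"]) auto
qed

lemma hitting_time_bounds:
  assumes \<Delta>: "\<Delta> > 0" and \<eta>: "\<eta> > 0"
  shows "\<exists>C>0. \<forall>n u. (\<forall>x\<in>{1..n}. 0 < u x \<and> u x < 1) \<longrightarrow> regular_env \<Delta> \<eta> n u \<longrightarrow>
    real (Suc n) powr (max 2 \<Delta> - 2 * \<eta>) \<le> C * hitting_time u (Suc n) \<and>
    hitting_time u (Suc n) \<le> C * real (Suc n) powr (max 2 \<Delta> + 3 * \<eta>)"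
proof -
  obtain c where c: "c > 0" and low: "\<And>n. c * real (Suc n) powr max 2 \<Delta>
    \<le> (\<Sum>x\<le>n. \<Sum>y\<le>x. (real (x + 1) / real (y + 1)) powr (\<Delta> - 1))"
    using sum_ratio_powr_lower[OF \<Delta>] by blast
  define C where "C = max (1 / c) (2 * (1 + 1 / \<eta>))"
  have C: "C > 0" "1 / c \<le> C" "2 * (1 + 1 / \<eta>) \<le> C" using c by (auto simp: C_def less_max_iff_disj)
  have "real (Suc n) powr (max 2 \<Delta> - 2 * \<eta>) \<le> C * hitting_time u (Suc n) \<and>
    hitting_time u (Suc n) \<le> C * real (Suc n) powr (max 2 \<Delta> + 3 * \<eta>)"
    if u: "\<forall>x\<in>{1..n}. 0 < u x \<and> u x < 1" and reg: "regular_env \<Delta> \<eta> n u" for n u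
  proof -
    define N where "N = real (Suc n)"
    have N: "N \<ge> 1" by (simp add: N_def)
    let ?W = "odds_prod u" and ?p = "\<lambda>x. real (x + 1) powr (\<Delta> - 1)"
    let ?S = "\<Sum>x\<le>n. \<Sum>y\<le>x. (real (x + 1) / real (y + 1)) powr (\<Delta> - 1)"
    let ?T = "\<Sum>x\<le>n. \<Sum>y\<le>x. ?W x / ?W y"
    have W: "0 < ?W x" "N powr - \<eta> * ?p x \<le> ?W x" "?W x \<le> N powr \<eta> * ?p x" if "x \<le> n" for x
      using that reg u odds_prod_pos[of x u] by (auto simp: regular_env_def N_def)
    have ratio: "N powr (- 2 * \<eta>) * (real (x + 1) / real (y + 1)) powr (\<Delta> - 1) \<le> ?W x / ?W y \<and>
      ?W x / ?W y \<le> N powr (2 * \<eta>) * (real (x + 1) / real (y + 1)) powr (\<Delta> - 1)"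
      if "x \<le> n" "y \<le> n" for x y
    proof
      have "N powr (- 2 * \<eta>) * (real (x + 1) / real (y + 1)) powr (\<Delta> - 1)
          = (N powr - \<eta> * ?p x) / (N powr \<eta> * ?p y)"
        using N by (simp add: powr_divide powr_minus field_simps flip: powr_add)
      also have "\<dots> \<le> ?W x / ?W y" using W that N by (intro frac_le) (auto simp: less_imp_le)
      finally show "N powr (- 2 * \<eta>) * (real (x + 1) / real (y + 1)) powr (\<Delta> - 1) \<le> ?W x / ?W y" .
      have "?W x / ?W y \<le> (N powr \<eta> * ?p x) / (N powr - \<eta> * ?p y)"
        using W that N by (intro frac_le) (auto simp: less_imp_le)
      also have "\<dots> = N powr (2 * \<eta>) * (real (x + 1) / real (y + 1)) powr (\<Delta> - 1)"
        using N by (simp add: powr_divide powr_minus field_simps flip: powr_add)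
      finally show "?W x / ?W y \<le> N powr (2 * \<eta>) * (real (x + 1) / real (y + 1)) powr (\<Delta> - 1)" .
    qed
    have T: "?T \<le> hitting_time u (Suc n)" "hitting_time u (Suc n) \<le> 2 * ?T"
    proof -
      have H: "hitting_time u (Suc n) = (\<Sum>x\<le>n. 2 * (\<Sum>y\<le>x. ?W x / ?W y) - 1)"
        by (simp add: hitting_time_def crossing_time_def lessThan_Suc_atMost)
      show "?T \<le> hitting_time u (Suc n)" unfolding H
      proof (rule sum_mono)
        fix x assume "x \<in> {..n}"
        then have "1 \<le> (\<Sum>y\<le>x. ?W x / ?W y)"
          using u by (intro sum_odds_prod_ratio_ge_1) auto
        then show "(\<Sum>y\<le>x. ?W x / ?W y) \<le> 2 * (\<Sum>y\<le>x. ?W x / ?W y) - 1" by simp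
      qed
      show "hitting_time u (Suc n) \<le> 2 * ?T"
        unfolding H sum_distrib_left[of 2 _ "{..n}"] by (intro sum_mono) simp
    qed
    have "N powr (max 2 \<Delta> - 2 * \<eta>) = (1 / c) * (N powr (- 2 * \<eta>) * (c * N powr max 2 \<Delta>))"
      using c by (simp add: powr_add[symmetric])
    also have "\<dots> \<le> (1 / c) * (N powr (- 2 * \<eta>) * ?S)"
      using low[of n] c by (intro mult_left_mono) (auto simp: N_def)
    also have "N powr (- 2 * \<eta>) * ?S \<le> ?T"
      unfolding sum_distrib_left by (intro sum_mono conjunct1[OF ratio]) auto
    then have "(1 / c) * (N powr (- 2 * \<eta>) * ?S) \<le> (1 / c) * ?T"
      using c by (intro mult_left_mono) auto
    also have "\<dots> \<le> (1 / c) * hitting_time u (Suc n)" using T c by (intro mult_left_mono) auto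
    also have "\<dots> \<le> C * hitting_time u (Suc n)"
    proof (rule mult_right_mono[OF C(2)])
      have "0 \<le> ?T" using W by (intro sum_nonneg divide_nonneg_nonneg less_imp_le[OF W(1)]) auto
      then show "0 \<le> hitting_time u (Suc n)" using T by linarith
    qed
    finally have 1: "N powr (max 2 \<Delta> - 2 * \<eta>) \<le> C * hitting_time u (Suc n)" .
    have "?T \<le> N powr (2 * \<eta>) * ?S"
      unfolding sum_distrib_left by (intro sum_mono conjunct2[OF ratio]) auto
    also have "\<dots> \<le> N powr (2 * \<eta>) * ((1 + 1 / \<eta>) * N powr (max 2 \<Delta> + \<eta>))"
      using sum_ratio_powr_upper[OF \<eta>, where n = n and \<Delta> = \<Delta>] by (intro mult_left_mono) (auto simp: N_def)
    also have "\<dots> = (1 + 1 / \<eta>) * N powr (max 2 \<Delta> + 3 * \<eta>)"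
      by (simp add: powr_add[symmetric] add.commute)
    finally have "hitting_time u (Suc n) \<le> (2 * (1 + 1 / \<eta>)) * N powr (max 2 \<Delta> + 3 * \<eta>)"
      unfolding mult.assoc using T by linarith
    also have "\<dots> \<le> C * N powr (max 2 \<Delta> + 3 * \<eta>)" by (rule mult_right_mono[OF C(3)]) simp
    finally show ?thesis using 1 by (simp add: N_def)
  qed
  then show ?thesis using C(1) by blast
qed


section \<open>Hitting probabilities and almost sure growth\<close>

text \<open>
  The Borel-Cantelli lemma is applied to the events that compare the walk up to time \<open>2 ^ k\<close> with
  this level.
\<close>

definition level :: "real \<Rightarrow> nat \<Rightarrow> nat" where
  "level \<kappa> k = nat \<lfloor>2 powr (\<kappa> * real k)\<rfloor>"

lemma level_bounds:
  assumes "\<kappa> > 0"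
  shows "real (level \<kappa> k) \<le> 2 powr (\<kappa> * real k)"
    and "2 powr (\<kappa> * real k) \<le> real (Suc (level \<kappa> k))"
    and "real (Suc (level \<kappa> k)) \<le> 2 * 2 powr (\<kappa> * real k)"
proof -
  have 1: "1 \<le> (2::real) powr (\<kappa> * real k)" using assms by (intro ge_one_powr_ge_zero) auto
  have r: "real (level \<kappa> k) = of_int \<lfloor>2 powr (\<kappa> * real k)\<rfloor>" by (simp add: level_def)
  show below: "real (level \<kappa> k) \<le> 2 powr (\<kappa> * real k)" unfolding r by (rule of_int_floor_le)
  show "2 powr (\<kappa> * real k) \<le> real (Suc (level \<kappa> k))"
    unfolding of_nat_Suc r add.commute[of 1] by (rule real_of_int_floor_add_one_ge)
  show "real (Suc (level \<kappa> k)) \<le> 2 * 2 powr (\<kappa> * real k)" using below 1 by simp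
qed

lemma summable_two_powr: "c < 0 \<Longrightarrow> summable (\<lambda>k. 2 powr (c * real k))"
proof -
  assume "c < 0"
  then have "(2::real) powr c < 1" by (simp add: powr_less_one)
  then have "summable (\<lambda>k. (2 powr c) ^ k)" by (intro summable_geometric) simp
  then show ?thesis by (simp add: powr_power mult.commute)
qed

lemma limsup_eq_PInfty_if_unbounded:
  fixes Y :: "nat \<Rightarrow> real"
  assumes "\<And>C. \<exists>n. C \<le> Y n"
  shows "limsup (\<lambda>n. ereal (Y n)) = \<infinity>"
proof -
  have "(SUP n\<in>{m..}. ereal (Y n)) = \<infinity>" for m
  proof (rule SUP_PInfty)
    fix j :: nat
    define C where "C = max (real j) (Max (Y ` {..m}) + 1)"
    obtain n where n: "C \<le> Y n" using assms by blast
    have "\<not> n \<le> m"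
    proof
      assume "n \<le> m"
      then have "Y n \<le> Max (Y ` {..m})" by (intro Max_ge) auto
      then show False using n by (simp add: C_def)
    qed
    then show "\<exists>n\<in>{m..}. ereal (real j) \<le> ereal (Y n)" using n by (intro bexI[of _ n]) (auto simp: C_def)
  qed
  then show ?thesis by (simp add: limsup_INF_SUP)
qed

locale linear_lerrw = lerrw M X lin_weight \<Delta>
  for M :: "'a measure" and X :: "nat \<Rightarrow> 'a \<Rightarrow> nat" and \<Delta> :: real +
  assumes \<Delta>_pos: "\<Delta> > 0"
begin

abbreviation "growth \<equiv> max 2 \<Delta>"

lemma reach_measurable: "{\<omega> \<in> space M. \<exists>i\<le>k. Suc n \<le> X i \<omega>} \<in> sets M"
  by measurable

text \<open>
  In a regular environment the hitting probability is at most time over expected hitting time. An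
  irregular environment contributes at most its own probability.
\<close>

lemma reach_prob_upper:
  assumes \<eta>: "\<eta> > 0"
  shows "\<exists>C>0. \<exists>\<delta>>0. \<forall>n k. prob {\<omega> \<in> space M. \<exists>i\<le>k. Suc n \<le> X i \<omega>}
    \<le> C * (real (Suc n) powr - \<delta> + real k * real (Suc n) powr - (growth - \<eta>))"
proof -
  obtain K \<delta> where K: "K \<ge> 0" "\<delta> > 0" and bad: "\<And>n. emeasure (env lin_weight \<Delta> n)
      {u \<in> space (env lin_weight \<Delta> n). \<not> regular_env \<Delta> (\<eta> / 2) n u}
      \<le> ennreal (K * real (Suc n) powr - \<delta>)"
    using irregular_env_prob[OF \<Delta>_pos, of "\<eta> / 2"] \<eta> by auto
  obtain C where C: "C > 0" and hit: "\<And>n u. \<forall>x\<in>{1..n}. 0 < u x \<and> u x < 1 \<Longrightarrow> regular_env \<Delta> (\<eta> / 2) n u \<Longrightarrow>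
    real (Suc n) powr (growth - 2 * (\<eta> / 2)) \<le> C * hitting_time u (Suc n)"
    using hitting_time_bounds[OF \<Delta>_pos, of "\<eta> / 2"] \<eta> by (metis half_gt_zero)
  have "prob {\<omega> \<in> space M. \<exists>i\<le>k. Suc n \<le> X i \<omega>}
    \<le> (K + C) * (real (Suc n) powr - \<delta> + real k * real (Suc n) powr - (growth - \<eta>))" for n k
  proof -
    let ?P = "env lin_weight \<Delta> n" and ?N = "real (Suc n)"
    let ?B = "{u \<in> space ?P. \<not> regular_env \<Delta> (\<eta> / 2) n u}"
    let ?r = "C * (real k * ?N powr - (growth - \<eta>))"
    interpret P: prob_space ?P by (rule prob_space_env[OF lin_weight_pos \<Delta>_pos])
    have "ennreal (prob {\<omega> \<in> space M. \<exists>i\<le>k. Suc n \<le> X i \<omega>}) = (\<integral>\<^sup>+u. ennreal (hit_prob u (Suc n) k 0) \<partial>?P)"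
      using emeasure_reach_eq[OF \<Delta>_pos] by (simp add: emeasure_eq_measure)
    also have "\<dots> \<le> (\<integral>\<^sup>+u. indicator ?B u + ennreal ?r \<partial>?P)"
    proof (rule nn_integral_mono_AE)
      show "AE u in ?P. ennreal (hit_prob u (Suc n) k 0) \<le> indicator ?B u + ennreal ?r"
        using AE_env[OF lin_weight_pos \<Delta>_pos] AE_space
      proof eventually_elim
        case (elim u)
        have u: "0 < u j \<and> u j < 1" if "1 \<le> j" "j < Suc n" for j using elim that by auto
        show ?case
        proof (cases "u \<in> ?B")
          case True
          have "ennreal (hit_prob u (Suc n) k 0) \<le> 1"
            using hit_prob_bounds[of "Suc n" u k 0, OF u] by simp
          then show ?thesis using True by (simp add: add_increasing2)
        next
          case False
          then have reg: "regular_env \<Delta> (\<eta> / 2) n u" using elim by auto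
          have H: "?N powr (growth - \<eta>) \<le> C * hitting_time u (Suc n)" using hit[OF elim(1) reg] by simp
          have p: "?N powr (growth - \<eta>) > 0" by simp
          have "hit_prob u (Suc n) k 0 * ?N powr (growth - \<eta>)
              \<le> hit_prob u (Suc n) k 0 * (C * hitting_time u (Suc n))"
            using hit_prob_bounds[of "Suc n" u k 0, OF u] H by (intro mult_left_mono) auto
          also have "\<dots> \<le> C * k" using hit_prob_le[of "Suc n" u k, OF u] C by simp
          finally have "hit_prob u (Suc n) k 0 \<le> C * k / ?N powr (growth - \<eta>)"
            using p by (simp only: pos_le_divide_eq)
          also have "\<dots> = ?r" using powr_minus_divide[of ?N "growth - \<eta>"] by simp
          finally show ?thesis using False by (simp add: ennreal_leI)
        qed
      qed
    qed
    also have "\<dots> = emeasure ?P ?B + ennreal ?r"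
      using irregular_env_measurable by (subst nn_integral_add) (auto simp: P.emeasure_space_1)
    also have "\<dots> \<le> ennreal (K * ?N powr - \<delta>) + ennreal ?r" by (intro add_mono bad order_refl)
    also have "\<dots> = ennreal (K * ?N powr - \<delta> + ?r)" using K C by (simp add: ennreal_plus)
    finally have "prob {\<omega> \<in> space M. \<exists>i\<le>k. Suc n \<le> X i \<omega>} \<le> K * ?N powr - \<delta> + ?r"
      using K C by (subst (asm) ennreal_le_iff) auto
    also have "\<dots> \<le> (K + C) * ?N powr - \<delta> + (K + C) * (real k * ?N powr - (growth - \<eta>))"
      using K C by (intro add_mono mult_right_mono) auto
    finally show ?thesis by (simp only: distrib_left)
  qed
  then show ?thesis using K C by (intro exI[of _ "K + C"] conjI exI[of _ \<delta>]) auto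
qed

lemma miss_prob_upper:
  assumes \<eta>: "\<eta> > 0"
  shows "\<exists>C>0. \<exists>\<delta>>0. \<forall>n k. k > 0 \<longrightarrow> prob {\<omega> \<in> space M. \<not> (\<exists>i\<le>k. Suc n \<le> X i \<omega>)}
    \<le> C * (real (Suc n) powr - \<delta> + real (Suc n) powr (growth + \<eta>) / real k)"
proof -
  obtain K \<delta> where K: "K \<ge> 0" "\<delta> > 0" and bad: "\<And>n. emeasure (env lin_weight \<Delta> n)
      {u \<in> space (env lin_weight \<Delta> n). \<not> regular_env \<Delta> (\<eta> / 3) n u}
      \<le> ennreal (K * real (Suc n) powr - \<delta>)"
    using irregular_env_prob[OF \<Delta>_pos, of "\<eta> / 3"] \<eta> by auto
  have \<eta>3: "\<eta> / 3 > 0" using \<eta> by simp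
  obtain C where C: "C > 0" and hit: "\<And>n u. \<forall>x\<in>{1..n}. 0 < u x \<and> u x < 1 \<Longrightarrow> regular_env \<Delta> (\<eta> / 3) n u \<Longrightarrow>
    hitting_time u (Suc n) \<le> C * real (Suc n) powr (growth + 3 * (\<eta> / 3))"
    using hitting_time_bounds[OF \<Delta>_pos \<eta>3] by blast
  have "prob {\<omega> \<in> space M. \<not> (\<exists>i\<le>k. Suc n \<le> X i \<omega>)}
    \<le> (K + C) * (real (Suc n) powr - \<delta> + real (Suc n) powr (growth + \<eta>) / real k)" if k: "k > 0" for n k
  proof -
    let ?P = "env lin_weight \<Delta> n" and ?N = "real (Suc n)"
    let ?B = "{u \<in> space ?P. \<not> regular_env \<Delta> (\<eta> / 3) n u}"
    let ?R = "{\<omega> \<in> space M. \<exists>i\<le>k. Suc n \<le> X i \<omega>}"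
    let ?h = "\<lambda>u. hit_prob u (Suc n) k 0"
    let ?r = "C * (?N powr (growth + \<eta>) / real k)"
    interpret P: prob_space ?P by (rule prob_space_env[OF lin_weight_pos \<Delta>_pos])
    note measurable_hit_prob[measurable]
    have one: "ennreal (prob ?R) + (\<integral>\<^sup>+u. ennreal (1 - ?h u) \<partial>?P) = 1"
    proof -
      have "ennreal (prob ?R) = (\<integral>\<^sup>+u. ennreal (?h u) \<partial>?P)"
        using emeasure_reach_eq[OF \<Delta>_pos] by (simp add: emeasure_eq_measure)
      then have "ennreal (prob ?R) + (\<integral>\<^sup>+u. ennreal (1 - ?h u) \<partial>?P)
          = (\<integral>\<^sup>+u. ennreal (?h u) + ennreal (1 - ?h u) \<partial>?P)"
        by (subst nn_integral_add) auto
      also have "\<dots> = (\<integral>\<^sup>+u. 1 \<partial>?P)"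
      proof (rule nn_integral_cong_AE)
        show "AE u in ?P. ennreal (?h u) + ennreal (1 - ?h u) = 1"
          using AE_env[OF lin_weight_pos \<Delta>_pos]
        proof eventually_elim
          case (elim u)
          then have u: "0 < u j \<and> u j < 1" if "1 \<le> j" "j < Suc n" for j using that by auto
          show ?case using hit_prob_bounds[of "Suc n" u k 0, OF u]
            by (simp flip: ennreal_plus)
        qed
      qed
      finally show ?thesis by (simp add: P.emeasure_space_1)
    qed
    have "(\<integral>\<^sup>+u. ennreal (1 - ?h u) \<partial>?P) \<le> (\<integral>\<^sup>+u. indicator ?B u + ennreal ?r \<partial>?P)"
    proof (rule nn_integral_mono_AE)
      show "AE u in ?P. ennreal (1 - ?h u) \<le> indicator ?B u + ennreal ?r"
        using AE_env[OF lin_weight_pos \<Delta>_pos] AE_space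
      proof eventually_elim
        case (elim u)
        have u: "0 < u j \<and> u j < 1" if "1 \<le> j" "j < Suc n" for j using elim that by auto
        show ?case
        proof (cases "u \<in> ?B")
          case True
          have "ennreal (1 - ?h u) \<le> 1"
            using hit_prob_bounds[of "Suc n" u k 0, OF u] by simp
          then show ?thesis using True by (simp add: add_increasing2)
        next
          case False
          then have reg: "regular_env \<Delta> (\<eta> / 3) n u" using elim by auto
          have "real k * (1 - ?h u) \<le> hitting_time u (Suc n)"
            using not_hit_prob_le[of "Suc n" u k, OF u] by simp
          also have "\<dots> \<le> C * ?N powr (growth + \<eta>)" using hit[OF elim(1) reg] by simp
          finally have "1 - ?h u \<le> ?r" using k by (simp add: field_simps)
          then show ?thesis using False by (simp add: ennreal_leI)
        qed
      qed
    qed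
    also have "\<dots> = emeasure ?P ?B + ennreal ?r"
      using irregular_env_measurable by (subst nn_integral_add) (auto simp: P.emeasure_space_1)
    also have "\<dots> \<le> ennreal (K * ?N powr - \<delta>) + ennreal ?r" by (intro add_mono bad order_refl)
    also have "\<dots> = ennreal (K * ?N powr - \<delta> + ?r)" using K C by (simp add: ennreal_plus)
    finally have le: "(\<integral>\<^sup>+u. ennreal (1 - ?h u) \<partial>?P) \<le> ennreal (K * ?N powr - \<delta> + ?r)" .
    have "1 \<le> ennreal (prob ?R) + ennreal (K * ?N powr - \<delta> + ?r)"
      unfolding one[symmetric] by (intro add_left_mono le)
    then have "ennreal 1 \<le> ennreal (prob ?R + (K * ?N powr - \<delta> + ?r))"
      using K C by (simp add: ennreal_plus)
    then have "1 \<le> prob ?R + (K * ?N powr - \<delta> + ?r)"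
      using K C by (subst (asm) ennreal_le_iff) auto
    moreover have "prob {\<omega> \<in> space M. \<not> (\<exists>i\<le>k. Suc n \<le> X i \<omega>)} = 1 - prob ?R"
      using prob_neg[OF reach_measurable] by simp
    ultimately have "prob {\<omega> \<in> space M. \<not> (\<exists>i\<le>k. Suc n \<le> X i \<omega>)} \<le> K * ?N powr - \<delta> + ?r" by linarith
    also have "\<dots> \<le> (K + C) * ?N powr - \<delta> + (K + C) * (?N powr (growth + \<eta>) / real k)"
      using K C by (intro add_mono mult_right_mono) auto
    finally show ?thesis by (simp only: distrib_left)
  qed
  then show ?thesis using K C by (intro exI[of _ "K + C"] conjI exI[of _ \<delta>]) auto
qed

lemma eventually_below_level:
  assumes \<kappa>: "\<kappa> > 1 / growth"
  shows "AE \<omega> in M. eventually (\<lambda>k. \<forall>i\<le>2 ^ k. X i \<omega> \<le> level \<kappa> k) sequentially"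
proof -
  have g: "growth > 0" "1 / growth > 0" by auto
  then have \<kappa>0: "\<kappa> > 0" using \<kappa> by linarith
  have gk: "1 / \<kappa> < growth" using \<kappa> \<kappa>0 g by (simp add: field_simps)
  define \<eta> where "\<eta> = (growth - 1 / \<kappa>) / 2"
  have \<eta>: "\<eta> > 0" using gk by (simp add: \<eta>_def)
  have ge: "1 / \<kappa> < growth - \<eta>" using gk by (simp add: \<eta>_def field_simps)
  then have ge0: "growth - \<eta> > 0" using \<kappa>0 by (smt (verit) divide_pos_pos)
  have e2: "1 - \<kappa> * (growth - \<eta>) < 0" using ge \<kappa>0 by (simp add: field_simps)
  obtain C \<delta> where C: "C > 0" "\<delta> > 0" and bd: "\<And>n k. prob {\<omega> \<in> space M. \<exists>i\<le>k. Suc n \<le> X i \<omega>}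
    \<le> C * (real (Suc n) powr - \<delta> + real k * real (Suc n) powr - (growth - \<eta>))"
    using reach_prob_upper[OF \<eta>] by blast
  define A where "A k = {\<omega> \<in> space M. \<exists>i\<le>2 ^ k. Suc (level \<kappa> k) \<le> X i \<omega>}" for k :: nat
  have Am: "A k \<in> sets M" for k unfolding A_def by measurable
  have bound: "prob (A k) \<le> C * (2 powr ((- \<kappa> * \<delta>) * real k) + 2 powr ((1 - \<kappa> * (growth - \<eta>)) * real k))" for k
  proof -
    let ?N = "real (Suc (level \<kappa> k))"
    have N: "2 powr (\<kappa> * real k) \<le> ?N" by (rule level_bounds(2)[OF \<kappa>0])
    have "?N powr - \<delta> \<le> (2 powr (\<kappa> * real k)) powr - \<delta>"
      using N C by (intro powr_mono2') auto
    moreover have "?N powr - (growth - \<eta>) \<le> (2 powr (\<kappa> * real k)) powr - (growth - \<eta>)"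
      using N ge0 by (intro powr_mono2') auto
    ultimately have "prob (A k) \<le> C * ((2 powr (\<kappa> * real k)) powr - \<delta>
        + real (2 ^ k) * (2 powr (\<kappa> * real k)) powr - (growth - \<eta>))"
      unfolding A_def using C by (intro order_trans[OF bd] mult_left_mono add_mono) auto
    also have "(2 powr (\<kappa> * real k)) powr - \<delta> = 2 powr ((- \<kappa> * \<delta>) * real k)"
      by (simp add: powr_powr mult_ac)
    also have "real (2 ^ k) * (2 powr (\<kappa> * real k)) powr - (growth - \<eta>)
        = 2 powr ((1 - \<kappa> * (growth - \<eta>)) * real k)"
      by (simp add: powr_powr powr_realpow[symmetric] powr_add[symmetric] algebra_simps)
    finally show ?thesis .
  qed
  have S: "summable (\<lambda>k. C * (2 powr ((- \<kappa> * \<delta>) * real k) + 2 powr ((1 - \<kappa> * (growth - \<eta>)) * real k)))"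
    using e2 \<kappa>0 C by (intro summable_mult summable_add summable_two_powr) auto
  have "summable (\<lambda>k. prob (A k))"
    by (rule summable_comparison_test'[OF S, of 0])
       (simp only: real_norm_def abs_of_nonneg[OF measure_nonneg] bound)
  then have "AE \<omega> in M. eventually (\<lambda>k. \<omega> \<in> space M - A k) sequentially"
    by (intro borel_cantelli_AE1 Am) (simp_all add: emeasure_eq_measure)
  then show ?thesis
    by eventually_elim (erule eventually_mono, force simp: A_def Suc_le_eq not_less)
qed

lemma eventually_reaches_level:
  assumes \<kappa>0: "\<kappa> > 0" and \<kappa>: "\<kappa> < 1 / growth"
  shows "AE \<omega> in M. eventually (\<lambda>k. \<exists>i\<le>2 ^ k. Suc (level \<kappa> k) \<le> X i \<omega>) sequentially"
proof -
  have "growth > 0" by auto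
  then have gk: "growth < 1 / \<kappa>" using \<kappa> \<kappa>0 by (metis mult.commute pos_less_divide_eq)
  define \<eta> where "\<eta> = (1 / \<kappa> - growth) / 2"
  have \<eta>: "\<eta> > 0" using gk by (simp add: \<eta>_def)
  have "g + (r - g) / 2 < r" if "g < r" for g r :: real using that by (simp add: field_simps)
  from this[OF gk] have "growth + \<eta> < 1 / \<kappa>" by (simp only: \<eta>_def)
  then have e2: "\<kappa> * (growth + \<eta>) - 1 < 0" using \<kappa>0 by (simp add: field_simps)
  have ge0: "growth + \<eta> \<ge> 0" using \<eta> by simp
  obtain C \<delta> where C: "C > 0" "\<delta> > 0" and bd: "\<And>n k. k > 0 \<Longrightarrow> prob {\<omega> \<in> space M. \<not> (\<exists>i\<le>k. Suc n \<le> X i \<omega>)}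
    \<le> C * (real (Suc n) powr - \<delta> + real (Suc n) powr (growth + \<eta>) / real k)"
    using miss_prob_upper[OF \<eta>] by blast
  define A where "A k = {\<omega> \<in> space M. \<not> (\<exists>i\<le>2 ^ k. Suc (level \<kappa> k) \<le> X i \<omega>)}" for k :: nat
  have Am: "A k \<in> sets M" for k unfolding A_def by measurable
  have bound: "prob (A k) \<le> C * (2 powr ((- \<kappa> * \<delta>) * real k)
      + 2 powr (growth + \<eta>) * 2 powr ((\<kappa> * (growth + \<eta>) - 1) * real k))" for k
  proof -
    let ?N = "real (Suc (level \<kappa> k))"
    have N: "2 powr (\<kappa> * real k) \<le> ?N" "?N \<le> 2 * 2 powr (\<kappa> * real k)"
      using level_bounds[OF \<kappa>0] by auto
    have "?N powr - \<delta> \<le> (2 powr (\<kappa> * real k)) powr - \<delta>"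
      using N C by (intro powr_mono2') auto
    moreover have "?N powr (growth + \<eta>) \<le> (2 * 2 powr (\<kappa> * real k)) powr (growth + \<eta>)"
      using N ge0 by (intro powr_mono2) auto
    ultimately have "prob (A k) \<le> C * ((2 powr (\<kappa> * real k)) powr - \<delta>
        + (2 * 2 powr (\<kappa> * real k)) powr (growth + \<eta>) / real (2 ^ k))"
      unfolding A_def using C by (intro order_trans[OF bd] mult_left_mono add_mono divide_right_mono) auto
    also have "(2 powr (\<kappa> * real k)) powr - \<delta> = 2 powr ((- \<kappa> * \<delta>) * real k)"
      by (simp add: powr_powr mult_ac)
    also have "(2 * 2 powr (\<kappa> * real k)) powr (growth + \<eta>) / real (2 ^ k)
        = 2 powr (growth + \<eta>) * 2 powr ((\<kappa> * (growth + \<eta>) - 1) * real k)"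
      by (simp add: powr_mult powr_powr powr_realpow[symmetric] powr_diff algebra_simps)
    finally show ?thesis .
  qed
  have S: "summable (\<lambda>k. C * (2 powr ((- \<kappa> * \<delta>) * real k)
      + 2 powr (growth + \<eta>) * 2 powr ((\<kappa> * (growth + \<eta>) - 1) * real k)))"
    using e2 \<kappa>0 C by (intro summable_mult summable_add summable_two_powr) auto
  have "summable (\<lambda>k. prob (A k))"
    by (rule summable_comparison_test'[OF S, of 0])
       (simp only: real_norm_def abs_of_nonneg[OF measure_nonneg] bound)
  then have "AE \<omega> in M. eventually (\<lambda>k. \<omega> \<in> space M - A k) sequentially"
    by (intro borel_cantelli_AE1 Am) (simp_all add: emeasure_eq_measure)
  then show ?thesis
    by eventually_elim (erule eventually_mono, auto simp: A_def)
qed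

text \<open>
  A time \<open>n\<close> between \<open>2 ^ k\<close> and \<open>2 ^ (k + 1)\<close> inherits the bound at the later time, which is larger
  only by the constant factor \<open>2 powr \<kappa>\<close>.
\<close>

lemma limit_zero:
  assumes \<beta>: "\<beta> > 1 / growth"
  shows "AE \<omega> in M. (\<lambda>n. real (X n \<omega>) / real n powr \<beta>) \<longlonglongrightarrow> 0"
proof -
  obtain \<kappa> where \<kappa>: "1 / growth < \<kappa>" "\<kappa> < \<beta>" using \<beta> dense by blast
  have "1 / growth > 0" by auto
  then have \<kappa>0: "\<kappa> > 0" using \<kappa> by linarith
  show ?thesis using eventually_below_level[OF \<kappa>(1)]
  proof eventually_elim
    case (elim \<omega>)
    then obtain k0 where k0: "\<And>k i. k0 \<le> k \<Longrightarrow> i \<le> 2 ^ k \<Longrightarrow> X i \<omega> \<le> level \<kappa> k"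
      by (auto simp: eventually_sequentially)
    have bd: "real (X n \<omega>) / real n powr \<beta> \<le> 2 powr \<kappa> * real n powr (\<kappa> - \<beta>)" if n: "n \<ge> 2 ^ k0" for n
    proof -
      have n0: "n > 0" using n by (metis gr0I not_le zero_less_numeral zero_less_power)
      obtain k where k: "2 ^ k \<le> n" "n < 2 ^ (k + 1)" using ex_power_ivl1[of 2 n] n0 by auto
      have "(2::nat) ^ k0 < 2 ^ (k + 1)" using n k by linarith
      then have "k0 < k + 1" by (rule power_less_imp_less_exp[rotated]) simp
      then have "X n \<omega> \<le> level \<kappa> (k + 1)" using k0[of "k + 1" n] k by simp
      then have "real (X n \<omega>) \<le> 2 powr (\<kappa> * real (k + 1))"
        using level_bounds(1)[OF \<kappa>0, of "k + 1"] by linarith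
      also have "\<dots> = 2 powr \<kappa> * (real (2 ^ k)) powr \<kappa>"
        by (simp add: powr_realpow[symmetric] powr_powr powr_add[symmetric] algebra_simps)
      also have "\<dots> \<le> 2 powr \<kappa> * real n powr \<kappa>"
        using k(1) \<kappa>0 by (intro mult_left_mono powr_mono2) (auto simp: of_nat_le_iff[symmetric] simp del: of_nat_le_iff)
      finally have "real (X n \<omega>) / real n powr \<beta> \<le> 2 powr \<kappa> * real n powr \<kappa> / real n powr \<beta>"
        by (rule divide_right_mono) simp
      then show ?thesis by (simp add: powr_diff)
    qed
    show ?case
    proof (rule tendsto_sandwich)
      show "eventually (\<lambda>n. 0 \<le> real (X n \<omega>) / real n powr \<beta>) sequentially" by simp
      show "eventually (\<lambda>n. real (X n \<omega>) / real n powr \<beta> \<le> 2 powr \<kappa> * real n powr (\<kappa> - \<beta>)) sequentially"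
        using bd eventually_ge_at_top by (rule eventually_mono[rotated])
      have "(\<lambda>n. real n powr (\<kappa> - \<beta>)) \<longlonglongrightarrow> 0"
        using \<kappa> by (intro tendsto_neg_powr filterlim_real_sequentially) auto
      from tendsto_mult_right_zero[OF this]
      show "(\<lambda>n. 2 powr \<kappa> * real n powr (\<kappa> - \<beta>)) \<longlonglongrightarrow> 0" .
    qed simp
  qed
qed

text \<open>
  If the walk has reached the level of order \<open>2 powr (\<kappa> k)\<close> at some time \<open>i \<le> 2 ^ k\<close>, then
  \<open>X i / i powr \<beta>\<close> is at least \<open>2 powr ((\<kappa> - \<beta>) k)\<close> for \<open>\<beta> \<ge> 0\<close>. A negative \<open>\<beta>\<close> only helps, as
  \<open>i \<ge> 1\<close>; this is why \<open>\<kappa>\<close> is compared with \<open>max \<beta> 0\<close>.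
\<close>

lemma limsup_infinite:
  assumes \<beta>: "\<beta> < 1 / growth"
  shows "AE \<omega> in M. limsup (\<lambda>n. ereal (real (X n \<omega>) / real n powr \<beta>)) = \<infinity>"
proof -
  have "max \<beta> 0 < 1 / growth" using \<beta> by auto
  then obtain \<kappa> where \<kappa>: "max \<beta> 0 < \<kappa>" "\<kappa> < 1 / growth" using dense by blast
  have \<kappa>0: "\<kappa> > 0" using \<kappa> by simp
  have start': "AE \<omega> in M. X 0 \<omega> = 0" using start by (subst (asm) prob_eq_1) auto
  show ?thesis using eventually_reaches_level[OF \<kappa>0 \<kappa>(2)] start'
  proof eventually_elim
    case (elim \<omega>)
    show ?case
    proof (rule limsup_eq_PInfty_if_unbounded)
      fix C :: real
      define d where "d = \<kappa> - max \<beta> 0"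
      have "d > 0" using \<kappa> by (simp add: d_def)
      then have "filterlim (\<lambda>k. 2 powr (d * real k)) at_top sequentially" by real_asymp
      then have "eventually (\<lambda>k. C \<le> 2 powr ((\<kappa> - max \<beta> 0) * real k)) sequentially"
        by (auto simp: filterlim_at_top d_def)
      from eventually_happens'[OF _ eventually_conj[OF this elim(1)]]
      obtain k i where k: "C \<le> 2 powr ((\<kappa> - max \<beta> 0) * real k)"
        and i: "i \<le> 2 ^ k" "Suc (level \<kappa> k) \<le> X i \<omega>" by auto
      have i0: "i > 0" using i elim(2) by (cases "i = 0") auto
      have "C \<le> 2 powr (\<kappa> * real k) / real (2 ^ k) powr max \<beta> 0"
        using k by (simp add: powr_realpow[symmetric] powr_powr powr_diff[symmetric] algebra_simps)
      also have "\<dots> \<le> real (X i \<omega>) / real i powr \<beta>"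
      proof (rule frac_le)
        show "2 powr (\<kappa> * real k) \<le> real (X i \<omega>)"
          using level_bounds(2)[OF \<kappa>0, of k] i(2) by linarith
        have "real i powr \<beta> \<le> real i powr max \<beta> 0" using i0 by (intro powr_mono) auto
        also have "\<dots> \<le> real (2 ^ k) powr max \<beta> 0"
          using i(1) by (intro powr_mono2) (auto simp: of_nat_le_iff[symmetric] simp del: of_nat_le_iff)
        finally show "real i powr \<beta> \<le> real (2 ^ k) powr max \<beta> 0" .
      qed (use i0 in auto)
      finally show "\<exists>n. C \<le> real (X n \<omega>) / real n powr \<beta>" by blast
    qed
  qed
qed

end

theorem theorem2p4:
  fixes M :: "'a measure" and X :: "nat \<Rightarrow> 'a \<Rightarrow> nat" and \<Delta> :: real
  assumes "\<Delta> > 0"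
    and "lerrw M X (\<lambda>x. if x = 0 then 1 else real x) \<Delta>"
  shows "(\<Delta> > 2 \<longrightarrow> (\<forall>\<epsilon>>0. AE \<omega> in M.
            limsup (\<lambda>n. ereal (real (X n \<omega>) / real n powr ((1 - \<epsilon>) / \<Delta>))) = \<infinity> \<and>
            (\<lambda>n. real (X n \<omega>) / real n powr ((1 + \<epsilon>) / \<Delta>)) \<longlonglongrightarrow> 0)) \<and>
         (\<Delta> \<le> 2 \<longrightarrow> (\<forall>\<epsilon>>0. AE \<omega> in M.
            limsup (\<lambda>n. ereal (real (X n \<omega>) / real n powr ((1 - \<epsilon>) / 2))) = \<infinity> \<and>
            (\<lambda>n. real (X n \<omega>) / real n powr ((1 + \<epsilon>) / 2)) \<longlonglongrightarrow> 0))"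
proof -
  have "(\<lambda>x. if x = 0 then 1 else real x) = lin_weight" by (auto simp: lin_weight_def)
  then interpret linear_lerrw M X \<Delta>
    using assms by (simp add: linear_lerrw_def linear_lerrw_axioms_def)
  have *: "AE \<omega> in M. limsup (\<lambda>n. ereal (real (X n \<omega>) / real n powr ((1 - \<epsilon>) / growth))) = \<infinity> \<and>
      (\<lambda>n. real (X n \<omega>) / real n powr ((1 + \<epsilon>) / growth)) \<longlonglongrightarrow> 0" if "\<epsilon> > 0" for \<epsilon>
  proof -
    have "(1 - \<epsilon>) / growth < 1 / growth" "1 / growth < (1 + \<epsilon>) / growth"
      using that by (auto intro!: divide_strict_right_mono)
    from limsup_infinite[OF this(1)] limit_zero[OF this(2)]
    show ?thesis by eventually_elim auto
  qed
  show ?thesis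
  proof (intro conjI impI allI)
    fix \<epsilon> :: real assume "\<Delta> > 2" "\<epsilon> > 0"
    then have "growth = \<Delta>" by simp
    with *[OF \<open>\<epsilon> > 0\<close>] show "AE \<omega> in M.
            limsup (\<lambda>n. ereal (real (X n \<omega>) / real n powr ((1 - \<epsilon>) / \<Delta>))) = \<infinity> \<and>
            (\<lambda>n. real (X n \<omega>) / real n powr ((1 + \<epsilon>) / \<Delta>)) \<longlonglongrightarrow> 0"
      by (simp only:)
  next
    fix \<epsilon> :: real assume "\<Delta> \<le> 2" "\<epsilon> > 0"
    then have "growth = 2" by simp
    with *[OF \<open>\<epsilon> > 0\<close>] show "AE \<omega> in M.
            limsup (\<lambda>n. ereal (real (X n \<omega>) / real n powr ((1 - \<epsilon>) / 2))) = \<infinity> \<and>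
            (\<lambda>n. real (X n \<omega>) / real n powr ((1 + \<epsilon>) / 2)) \<longlonglongrightarrow> 0"
      by (simp only:)
  qed
qed

end
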